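(* For any $\mathscr{B}\subset\mathbb{N}$, there exists a unique taut set $\mathscr{B}'\subset\mathbb{N}$ such that $\mathcal{F}_{\mathscr{B}'}\subset\mathcal{F}_{\mathscr{B}}$, $\widetilde{X}_{\eta'}\subset\widetilde{X}_\eta$ and $\mathcal{P}(S,\widetilde{X}_\eta)=\mathcal{P}(S,\widetilde{X}_{\eta'})$.
   Context: $\mathbb{N}=\{1,2,\dots\}$. For $\mathscr{B}\subset\mathbb{N}$ let $\mathcal{M}_{\mathscr{B}}:=\bigcup_{b\in\mathscr{B}}b\mathbb{Z}$, $\mathcal{F}_{\mathscr{B}}:=\mathbb{Z}\setminus\mathcal{M}_{\mathscr{B}}$, and let $\eta\in\{0,1\}^{\mathbb{Z}}$ be the characteristic function of $\mathcal{F}_{\mathscr{B}}$; similarly $\eta'$ is the characteristic function of $\mathcal{F}_{\mathscr{B}'}$. $S$ is the left shift on $\{0,1\}^{\mathbb{Z}}$ (product topology), and $X_\eta$ is the closure of $\{S^m\eta : m\in\mathbb{Z}\}$. A subshift $X\subset\{0,1\}^{\mathbb{Z}}$ (closed, $S$-invariant set) is hereditary if $x\in X$ and $y\le x$ coordinatewise imply $y\in X$. $\widetilde{X}_\eta$ is the smallest hereditary subshift containing $X_\eta$ (and $\widetilde{X}_{\eta'}$ is defined likewise from $\eta'$). $\mathcal{P}(S,X)$ is the set of Borel probability $S$-invariant measures on $X$; for $X'\subset X$, measures on $X'$ are regarded as measures on $X$ supported on $X'$. The logarithmic density of $A\subset\mathbb{Z}$ is $\boldsymbol{\delta}(A)=\lim_{N\to\infty}\frac{1}{\log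 N}\sum_{a\in A,1\le a\le N}\frac1a$ when the limit exists; it always exists for $A=\mathcal{M}_{\mathscr{B}}$ (Davenport–Erdős). $\mathscr{B}$ is taut if $\boldsymbol{\delta}(\mathcal{M}_{\mathscr{B}\setminus\{b\}})<\boldsymbol{\delta}(\mathcal{M}_{\mathscr{B}})$ for each $b\in\mathscr{B}$. *)

theory Defs
  imports "HOL-Probability.Probability"
begin

definition multiples :: "nat set \<Rightarrow> int set" where
  "multiples B = (\<Union>b\<in>B. range (\<lambda>k. int b * k))"

definition free_set :: "nat set \<Rightarrow> int set" where
  "free_set B = - multiples B"

(* If the limit does not exist, the value of lim is unspecified.  For sets of the form
   multiples B with 0 \<notin> B it exists by the Davenport-Erdos theorem. *)
definition log_density :: "int set \<Rightarrow> real" where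
  "log_density A = lim (\<lambda>N::nat. (\<Sum>a\<in>A \<inter> {1..int N}. 1 / real_of_int a) / ln (real N))"

definition taut :: "nat set \<Rightarrow> bool" where
  "taut B \<longleftrightarrow> (\<forall>b\<in>B. log_density (multiples (B - {b})) < log_density (multiples B))"

(* Points of {0,1}^Z are functions int \<Rightarrow> bool.  The type class instances provide the
   product of the discrete topologies, its Borel sets, and the coordinatewise order
   (False < True). *)
type_synonym config = "int \<Rightarrow> bool"

definition shift :: "config \<Rightarrow> config" where
  "shift x = (\<lambda>n. x (n + 1))"

(* The integer power S^m of the (invertible) shift; see shift_by_nat and
   shift_by_minus_nat. *)
definition shift_by :: "int \<Rightarrow> config \<Rightarrow> config" where
  "shift_by m x = (\<lambda>n. x (n + m))"

lemma shift_by_nat: "shift_by (int m) = shift ^^ m"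
proof (induction m)
  case 0
  show ?case by (simp add: shift_by_def fun_eq_iff)
next
  case (Suc m)
  have "shift_by (int (Suc m)) = shift \<circ> shift_by (int m)"
    by (simp add: fun_eq_iff shift_by_def shift_def algebra_simps)
  then show ?case using Suc by simp
qed

lemma shift_by_add: "shift_by m (shift_by n x) = shift_by (m + n) x"
  by (simp add: shift_by_def algebra_simps)

lemma bij_shift: "bij shift"
  by (rule bij_betw_byWitness[where f' = "shift_by (-1)"])
    (auto simp: shift_by_def shift_def)

lemma shift_by_minus_nat: "shift_by (- int m) = inv shift ^^ m"
proof (induction m)
  case 0
  show ?case by (simp add: shift_by_def fun_eq_iff)
next
  case (Suc m)
  have "inv shift = shift_by (-1)"
    by (rule inv_equality) (simp_all add: shift_by_def shift_def)
  then have "shift_by (- int (Suc m)) = inv shift \<circ> shift_by (- int m)"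
    by (simp add: fun_eq_iff shift_by_def algebra_simps)
  then show ?case using Suc by simp
qed

definition subshift :: "config set \<Rightarrow> bool" where
  "subshift X \<longleftrightarrow> closed X \<and> shift ` X = X"

definition hereditary :: "config set \<Rightarrow> bool" where
  "hereditary X \<longleftrightarrow> (\<forall>x\<in>X. \<forall>y. y \<le> x \<longrightarrow> y \<in> X)"

definition orbit_closure :: "config \<Rightarrow> config set" where
  "orbit_closure x = closure (range (\<lambda>m. shift_by m x))"

(* The smallest hereditary subshift containing X; see hereditary_hull. *)
definition hereditary_hull :: "config set \<Rightarrow> config set" where
  "hereditary_hull X = \<Inter>{Y. subshift Y \<and> hereditary Y \<and> X \<subseteq> Y}"

lemma hereditary_hull:
  shows "subshift (hereditary_hull X)" "hereditary (hereditary_hull X)" "X \<subseteq> hereditary_hull X"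
    and "\<And>Y. subshift Y \<Longrightarrow> hereditary Y \<Longrightarrow> X \<subseteq> Y \<Longrightarrow> hereditary_hull X \<subseteq> Y"
proof -
  let ?F = "{Y. subshift Y \<and> hereditary Y \<and> X \<subseteq> Y}"
  have "UNIV \<in> ?F"
    using bij_shift by (auto simp: subshift_def hereditary_def bij_def)
  then have "shift ` \<Inter>?F = (\<Inter>Y\<in>?F. shift ` Y)"
    using image_INT[of shift UNIV ?F "\<lambda>Y. Y"] bij_shift by (auto simp: bij_def)
  also have "\<dots> = \<Inter>?F"
    by (auto simp: subshift_def)
  finally show "subshift (hereditary_hull X)"
    unfolding subshift_def hereditary_hull_def by (auto intro!: closed_Inter simp: subshift_def)
  show "hereditary (hereditary_hull X)"
    unfolding hereditary_hull_def by (auto simp: hereditary_def)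
qed (auto simp: hereditary_hull_def)

definition eta :: "nat set \<Rightarrow> config" where
  "eta B = (\<lambda>n. n \<in> free_set B)"

definition X_tilde :: "nat set \<Rightarrow> config set" where
  "X_tilde B = hereditary_hull (orbit_closure (eta B))"

(* Measures on X are regarded as measures on the full shift that are supported on X, so
   that the sets of invariant measures of different subshifts can be compared directly. *)
definition invariant_measures :: "config set \<Rightarrow> config measure set" where
  "invariant_measures X =
     {\<mu>. prob_space \<mu> \<and> sets \<mu> = sets borel \<and> distr \<mu> borel shift = \<mu> \<and> emeasure \<mu> X = 1}"

end

theory Submission
  imports Defs "HOL-Number_Theory.Cong" "HOL-Real_Asymp.Real_Asymp"
begin

text \<open>
The proof turns densities into probabilities. Let \<open>\<omega>\<close> be a uniformly distributed random
profinite integer. For a finite set \<open>K\<close> of moduli and a pattern \<open>U\<close>, the probability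
\<open>free_prob K U\<close> that no \<open>\<omega> + u\<close> with \<open>u \<in> U\<close> is divisible by an element of \<open>K\<close> is the natural
density of the set of positions at which \<open>U\<close> occurs in the \<open>K\<close>-free numbers. For infinite \<open>B\<close>,
\<open>free_prob B U\<close> is the limit over the finite subsets of \<open>B\<close>, and continuity of measures makes this
limit easy to handle.

The link with actual integers is the theorem of Davenport and Erdos (\<open>davenport_erdos\<close>): the set
of multiples of \<open>B\<close> has logarithmic density \<open>1 - free_prob B {0}\<close>. Its quantitative form
(\<open>davenport_erdos_tail\<close>) says that the multiples of \<open>B\<close> that are not multiples of a large finite
part of \<open>B\<close> have small upper logarithmic density. Hence a pattern with \<open>free_prob B U > 0\<close> really
occurs in the \<open>B\<close>-free numbers (\<open>free_prob_pos_translate\<close>).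

A configuration lies in \<open>X_tilde B\<close> if and only if each finite part of its support has a translate
among the \<open>B\<close>-free numbers. Counting translates over one period, an invariant measure on
\<open>X_tilde B\<close> gives the cylinder of \<open>U\<close> mass at most \<open>free_prob B U\<close>; the Mirsky measure, the
distribution of the random set of all \<open>n\<close> such that \<open>\<omega> + n\<close> is \<open>B\<close>-free, gives it exactly
this mass. Thus the set of invariant measures determines, and is determined by, the family of
patterns with \<open>free_prob B U = 0\<close> (\<open>invariant_measures_subset_iff\<close>), and the theorem becomes a
statement about these families.

Existence (\<open>exists_taut\<close>): adjoin to \<open>B\<close> every \<open>c\<close> almost all of whose multiples are multiples of
\<open>B\<close>. This changes each \<open>free_prob B U\<close> by a countable union of null events only. Let \<open>B'\<close> be the set of
elements of the enlarged set that are minimal for divisibility. If \<open>B'\<close> were not taut at \<open>b\<close>, almost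
all multiples of \<open>b\<close> would be multiples of other elements; by Behrend's inequality the elements with
one particular value \<open>d\<close> of \<open>gcd c b\<close> would suffice to cover almost all multiples of \<open>d\<close>, so \<open>d\<close>
would have been adjoined, contradicting the minimality of \<open>b\<close>.

Uniqueness (\<open>taut_unique\<close>): let \<open>B\<close> and \<open>C\<close> be taut with the same null patterns and let \<open>b \<in> C\<close>. If the
multiples of \<open>b\<close> met the \<open>B\<close>-free integers with positive probability, then so would every residue
class modulo \<open>b\<close>, and choosing points one after the other gives a pattern that has positive
probability for \<open>B\<close> and meets all classes modulo \<open>b\<close>; such a pattern is null for \<open>C\<close>. So almost all
multiples of \<open>b\<close> are multiples of \<open>B\<close>, and tautness of \<open>B\<close> yields an element of \<open>B\<close> that divides \<open>b\<close>.
By symmetry, and because taut sets are primitive, \<open>B = C\<close>.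
\<close>

section \<open>The random profinite integer\<close>

text \<open>The profinite integer is modelled by a point \<open>\<omega>\<close> of the unit interval: if \<open>\<omega>\<close> has the digits
\<open>d\<^sub>1, d\<^sub>2, \<dots>\<close> in the factorial base (\<open>0 \<le> d\<^sub>k < k\<close>, \<open>d\<^sub>k\<close> of weight \<open>1 / k!\<close>), the profinite integer is
the series \<open>\<Sum> d\<^sub>k * (k - 1)!\<close>. The function below takes the first \<open>n\<close> digits, packed in
\<open>\<lfloor>n! * \<omega>\<rfloor>\<close>, to the \<open>n\<close>-th partial sum of this series, which is the residue modulo \<open>n!\<close>.\<close>
primrec digit_rev :: "nat \<Rightarrow> int \<Rightarrow> int" where
  "digit_rev 0 j = 0"
| "digit_rev (Suc n) j = digit_rev n (j div int (Suc n)) + (j mod int (Suc n)) * fact n"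

definition residue :: "nat \<Rightarrow> real \<Rightarrow> int" where
  "residue n \<omega> = digit_rev n \<lfloor>fact n * \<omega>\<rfloor>"

definition haar :: "real measure" where
  "haar = uniform_measure lborel {0..<1}"

lemma prob_space_haar: "prob_space haar"
  unfolding haar_def by (rule prob_space_uniform_measure) auto

interpretation haar: prob_space haar
  by (rule prob_space_haar)

lemma space_haar [simp]: "space haar = UNIV"
  by (simp add: haar_def)

lemma sets_haar [measurable_cong, simp]: "sets haar = sets borel"
  by (simp add: haar_def)

lemma digit_rev_range: "digit_rev n j \<in> {0..<fact n}"
proof (induction n arbitrary: j)
  case (Suc n)
  let ?q = "digit_rev n (j div int (Suc n))" and ?r = "j mod int (Suc n)"
  have q: "0 \<le> ?q" "?q < fact n"
    using Suc[of "j div int (Suc n)"] by (simp_all del: of_nat_Suc)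
  have r: "0 \<le> ?r" "?r \<le> int n"
    using pos_mod_bound[of "int (Suc n)" j] pos_mod_sign[of "int (Suc n)" j] by linarith+
  have "?r * fact n \<le> int n * fact n"
    using r by (intro mult_right_mono) auto
  moreover have "0 \<le> ?r * fact n"
    using r by simp
  moreover have "(fact (Suc n) :: int) = fact n + int n * fact n"
    by (simp add: algebra_simps)
  ultimately have "0 \<le> ?q + ?r * fact n" "?q + ?r * fact n < fact (Suc n)"
    using q by linarith+
  then show ?case by (simp only: digit_rev.simps atLeastLessThan_iff)
qed simp

text \<open>The residue modulo \<open>n!\<close> recovers the earlier digits, and the quotient is the last digit.\<close>
lemma inj_on_digit_rev: "inj_on (digit_rev n) {0..<fact n}"
proof (induction n)
  case (Suc n)
  show ?case
  proof (rule inj_onI)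
    fix i j :: int
    assume ij: "i \<in> {0..<fact (Suc n)}" "j \<in> {0..<fact (Suc n)}"
      and eq: "digit_rev (Suc n) i = digit_rev (Suc n) j"
    let ?m = "int (Suc n)"
    have div: "k div ?m \<in> {0..<fact n}" if "k \<in> {0..<fact (Suc n)}" for k
    proof -
      have "k < ?m * fact n" using that by simp
      moreover have "?m * (k div ?m) \<le> k"
        using mult_div_mod_eq[of ?m k] pos_mod_sign[of ?m k] by linarith
      ultimately have "?m * (k div ?m) < ?m * fact n" by linarith
      then have "k div ?m < fact n"
        by (simp only: mult_less_cancel_left)
      then show ?thesis using that by (simp add: pos_imp_zdiv_nonneg_iff)
    qed
    have split: "digit_rev (Suc n) k mod fact n = digit_rev n (k div ?m)"
        "digit_rev (Suc n) k div fact n = k mod ?m" for k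
      using digit_rev_range[of n "k div ?m"] by (simp_all del: of_nat_Suc)
    have "digit_rev n (i div ?m) = digit_rev n (j div ?m)" "i mod ?m = j mod ?m"
      using eq split[of i] split[of j] by metis+
    moreover from this(1) have "i div ?m = j div ?m"
      using Suc div[OF ij(1)] div[OF ij(2)] by (auto dest: inj_onD)
    ultimately show "i = j"
      by (metis div_mult_mod_eq)
  qed
qed (simp add: inj_on_def)

lemma bij_betw_digit_rev: "bij_betw (digit_rev n) {0..<fact n} {0..<fact n}"
  using inj_on_digit_rev digit_rev_range
  by (simp add: bij_betw_def endo_inj_surj image_subset_iff del: atLeastLessThan_iff)

lemma residue_Suc: "residue (Suc n) \<omega> = residue n \<omega> + (\<lfloor>fact (Suc n) * \<omega>\<rfloor> mod int (Suc n)) * fact n"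
proof -
  have "\<lfloor>fact (Suc n) * \<omega>\<rfloor> div int (Suc n) = \<lfloor>fact n * \<omega>\<rfloor>"
    using floor_divide_real_eq_div[of "int (Suc n)" "fact (Suc n) * \<omega>"]
    by (simp add: mult.assoc del: of_nat_Suc)
  then show ?thesis by (simp add: residue_def del: fact_Suc)
qed

text \<open>This compatibility of the residues is what makes the sequence \<open>residue n \<omega>\<close> a profinite integer.\<close>
lemma residue_cong:
  assumes "n \<le> m" shows "fact n dvd residue m \<omega> - residue n \<omega>"
  using assms
proof (induction m rule: dec_induct)
  case (step m)
  have "(fact n :: int) dvd fact m" using step by (simp add: fact_dvd)
  then have "fact n dvd (residue m \<omega> - residue n \<omega>) + (\<lfloor>fact (Suc m) * \<omega>\<rfloor> mod int (Suc m)) * fact m"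
    using step by (intro dvd_add) auto
  then show ?case by (simp add: residue_Suc algebra_simps)
qed simp

lemma residue_measurable [measurable]: "residue n \<in> measurable borel (count_space UNIV)"
  unfolding residue_def by measurable

text \<open>Each value of \<open>\<lfloor>n! * \<omega>\<rfloor>\<close> corresponds to an interval of length \<open>1 / n!\<close> and \<open>digit_rev n\<close> permutes
these values, so the residue modulo \<open>n!\<close> is uniform. Probabilities of events that depend on
finitely many moduli are therefore densities of periodic sets of integers.\<close>
lemma prob_residue:
  "measure haar {\<omega>. residue n \<omega> \<in> A} = card (A \<inter> {0..<fact n}) / fact n"
proof -
  let ?A = "{j\<in>{0..<fact n}. digit_rev n j \<in> A}"
  let ?I = "\<lambda>j::int. {of_int j / fact n ..< of_int (j + 1) / fact n :: real}"
  have floor: "\<lfloor>fact n * \<omega>\<rfloor> = j \<longleftrightarrow> \<omega> \<in> ?I j" for j \<omega>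
    by (simp add: floor_eq_iff field_simps)
  have unit: "\<omega> \<in> {0..<1} \<longleftrightarrow> \<lfloor>fact n * \<omega>\<rfloor> \<in> {0..<fact n}" for \<omega> :: real
  proof -
    have "\<lfloor>fact n * \<omega>\<rfloor> < fact n \<longleftrightarrow> fact n * \<omega> < fact n"
      by (simp add: floor_less_iff)
    moreover have "0 < (fact n :: real)" by simp
    ultimately show ?thesis by (simp add: zero_le_mult_iff del: fact_gt_zero)
  qed
  have "{0..<1} \<inter> {\<omega>. residue n \<omega> \<in> A} = (\<Union>j\<in>?A. ?I j)"
    unfolding set_eq_iff UN_iff floor[symmetric] Int_iff unit by (auto simp: residue_def)
  then have "measure lborel ({0..<1} \<inter> {\<omega>. residue n \<omega> \<in> A}) = measure lborel (\<Union>j\<in>?A. ?I j)"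
    by simp
  also have "\<dots> = (\<Sum>j\<in>?A. measure lborel (?I j))"
  proof (rule measure_finite_Union)
    show "disjoint_family_on ?I ?A"
      unfolding disjoint_family_on_def set_eq_iff Int_iff floor[symmetric] by auto
    show "finite ?A" by (rule finite_subset[of _ "{0..<fact n}"]) auto
  qed (auto simp: divide_right_mono)
  also have "\<dots> = (\<Sum>j\<in>?A. 1 / fact n)"
    by (intro sum.cong refl) (simp add: divide_right_mono diff_divide_distrib[symmetric])
  also have "\<dots> = card ?A / fact n" by simp
  also have "card ?A = card (A \<inter> {0..<fact n})"
  proof (rule bij_betw_same_card)
    show "bij_betw (digit_rev n) ?A (A \<inter> {0..<fact n})"
      using bij_betw_digit_rev[of n] unfolding bij_betw_def
      by (auto simp: inj_on_def simp del: atLeastLessThan_iff)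
  qed
  finally show ?thesis
    unfolding haar_def by (subst measure_uniform_measure) auto
qed

lemma int_dvd_fact: "0 < b \<Longrightarrow> b \<le> n \<Longrightarrow> int b dvd fact n"
  using dvd_fact[of b n] int_dvd_int_iff[of b "fact n"] by simp

section \<open>Sieving the random integer\<close>

text \<open>The residue modulo \<open>b!\<close> decides divisibility by \<open>b\<close>; by \<open>pdvd_iff\<close> every later residue gives the same
answer, so several moduli can be treated with one common residue.\<close>
definition pdvd :: "nat \<Rightarrow> int \<Rightarrow> real \<Rightarrow> bool" where
  "pdvd b u \<omega> \<longleftrightarrow> int b dvd residue b \<omega> + u"

lemma pdvd_iff:
  assumes "0 < b" "b \<le> n"
  shows "pdvd b u \<omega> \<longleftrightarrow> int b dvd residue n \<omega> + u"
proof -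
  have "int b dvd residue n \<omega> - residue b \<omega>"
    using residue_cong[OF assms(2)] int_dvd_fact[OF assms(1) order_refl] dvd_trans by blast
  from dvd_add_right_iff[OF this, of "residue b \<omega> + u"] show ?thesis
    by (simp add: pdvd_def)
qed

lemma pdvd_1 [simp]: "pdvd (Suc 0) u \<omega>"
  by (simp add: pdvd_def)

lemma pdvd_mono:
  assumes "a dvd b" "0 < b" "pdvd b u \<omega>" shows "pdvd a u \<omega>"
proof -
  have "0 < a" "a \<le> b" using assms by (auto intro: dvd_imp_le Nat.gr0I)
  then show ?thesis
    using assms pdvd_iff[of a b u \<omega>] by (simp add: pdvd_def) (meson dvd_trans int_dvd_int_iff)
qed

lemma pdvd_lcm:
  assumes "0 < a" "0 < b"
  shows "pdvd (lcm a b) u \<omega> \<longleftrightarrow> pdvd a u \<omega> \<and> pdvd b u \<omega>"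
proof -
  have *: "0 < lcm a b" using assms by (simp add: lcm_pos_nat)
  then have "a \<le> lcm a b" "b \<le> lcm a b" by (auto intro: dvd_imp_le)
  then show ?thesis
    using assms pdvd_iff[of a "lcm a b" u \<omega>] pdvd_iff[of b "lcm a b" u \<omega>]
    by (simp add: pdvd_def lcm_least_iff flip: lcm_int_int_eq)
qed

lemma pdvd_measurable [measurable]: "Measurable.pred borel (pdvd b u)"
proof -
  have "Measurable.pred borel (\<lambda>\<omega>. (\<lambda>r. int b dvd r + u) (residue b \<omega>))"
    by measurable
  then show ?thesis by (simp add: pdvd_def[abs_def])
qed

definition sieve :: "nat set \<Rightarrow> int set \<Rightarrow> real set" where
  "sieve B U = {\<omega>. \<forall>u\<in>U. \<forall>b\<in>B. \<not> pdvd b u \<omega>}"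

lemma sieve_measurable [measurable]: "sieve B U \<in> sets borel"
proof -
  have "Measurable.pred borel (\<lambda>\<omega>. \<forall>u\<in>U. \<forall>b\<in>B. \<not> pdvd b u \<omega>)"
    by (intro pred_intros_countable_bounded) (auto intro: countable_subset)
  then show ?thesis by (simp add: sieve_def pred_def)
qed

lemma sieve_antimono: "B \<subseteq> C \<Longrightarrow> U \<subseteq> V \<Longrightarrow> sieve C V \<subseteq> sieve B U"
  by (auto simp: sieve_def)

text \<open>For boundedly many moduli the sieved event only depends on one residue, and on it the condition
is that \<open>U\<close> occurs at that residue in the free integers.\<close>
lemma sieve_iff_free_set:
  assumes "\<And>b. b \<in> B \<Longrightarrow> 0 < b \<and> b \<le> n"
  shows "\<omega> \<in> sieve B U \<longleftrightarrow> (\<forall>u\<in>U. residue n \<omega> + u \<in> free_set B)"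
  using assms pdvd_iff[of _ n]
  by (fastforce simp: sieve_def free_set_def multiples_def dvd_def image_iff)

lemma free_set_iff: "m \<in> free_set B \<longleftrightarrow> (\<forall>b\<in>B. \<not> int b dvd m)"
  by (auto simp: free_set_def multiples_def dvd_def image_iff)

definition trunc :: "nat set \<Rightarrow> nat \<Rightarrow> nat set" where
  "trunc B n = {b\<in>B. b \<le> n}"

lemma finite_trunc [simp]: "finite (trunc B n)"
  by (auto simp: trunc_def)

lemma trunc_subset: "trunc B n \<subseteq> B"
  by (auto simp: trunc_def)

lemma sieve_LIMSEQ:
  assumes K: "\<And>n. K n \<subseteq> K (Suc n)" "(\<Union>n. K n) = B" and [measurable]: "E \<in> sets borel"
  shows "(\<lambda>n. measure haar (sieve (K n) U \<inter> E)) \<longlonglongrightarrow> measure haar (sieve B U \<inter> E)"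
proof -
  have "(\<Inter>n. sieve (K n) U) = sieve B U"
    using K(2) by (auto simp: sieve_def)
  then have eq: "(\<Inter>n. sieve (K n) U \<inter> E) = sieve B U \<inter> E"
    by blast
  have "decseq (\<lambda>n. sieve (K n) U \<inter> E)"
    by (intro decseq_SucI Int_mono sieve_antimono K) auto
  from haar.finite_Lim_measure_decseq[OF _ this] show ?thesis
    by (simp only: eq) (simp add: image_subset_iff)
qed

lemma sieve_trunc_LIMSEQ:
  assumes "E \<in> sets borel"
  shows "(\<lambda>n. measure haar (sieve (trunc B n) U \<inter> E)) \<longlonglongrightarrow> measure haar (sieve B U \<inter> E)"
  using assms by (intro sieve_LIMSEQ) (auto simp: trunc_def)

definition free_prob :: "nat set \<Rightarrow> int set \<Rightarrow> real" where
  "free_prob B U = measure haar (sieve B U)"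

lemma free_prob_trunc: "(\<lambda>n. free_prob (trunc B n) U) \<longlonglongrightarrow> free_prob B U"
  using sieve_trunc_LIMSEQ[of UNIV] by (simp add: free_prob_def)

lemma free_prob_antimono: "B \<subseteq> C \<Longrightarrow> U \<subseteq> V \<Longrightarrow> free_prob C V \<le> free_prob B U"
  unfolding free_prob_def by (intro haar.finite_measure_mono sieve_antimono) auto

lemma free_prob_nonneg [simp]: "0 \<le> free_prob B U"
  by (simp add: free_prob_def)

definition mult_prob :: "nat set \<Rightarrow> nat \<Rightarrow> real" where
  "mult_prob B a = measure haar (sieve B {0} \<inter> {\<omega>. pdvd a 0 \<omega>})"

lemma card_shift_period:
  fixes A :: "int set" and L :: int
  assumes L: "0 < L" and per: "\<And>m. m + L \<in> A \<longleftrightarrow> m \<in> A"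
  shows "card (A \<inter> {m..<m + L}) = card (A \<inter> {0..<L})"
proof -
  have per_nat: "m + L * int k \<in> A \<longleftrightarrow> m \<in> A" for m k
  proof (induction k)
    case (Suc k)
    have "m + L * int (Suc k) = (m + L * int k) + L" by (simp add: algebra_simps)
    then show ?case using Suc per by presburger
  qed simp
  have per': "m + L * k \<in> A \<longleftrightarrow> m \<in> A" for m k
    using per_nat[of m "nat k"] per_nat[of "m + L * k" "nat (- k)"] by (cases "0 \<le> k") auto
  have "bij_betw (\<lambda>x. x mod L) (A \<inter> {m..<m + L}) (A \<inter> {0..<L})"
  proof (rule bij_betw_byWitness[where f' = "\<lambda>x. m + (x - m) mod L"])
    have 1: "x mod L \<in> A \<longleftrightarrow> x \<in> A" for x
      using per'[of "x mod L" "x div L"] by simp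
    have 2: "m + (x - m) mod L \<in> A \<longleftrightarrow> x \<in> A" for x
    proof -
      have "m + (x - m) mod L + L * ((x - m) div L) = x" 
        by simp
      then show ?thesis using per'[of "m + (x - m) mod L" "(x - m) div L"] by simp
    qed
    show "\<forall>a\<in>A \<inter> {m..<m + L}. m + (a mod L - m) mod L = a"
      using L by (auto simp: mod_diff_left_eq)
    show "\<forall>a'\<in>A \<inter> {0..<L}. (m + (a' - m) mod L) mod L = a'"
      using L by (auto simp: mod_add_right_eq)
    show "(\<lambda>x. x mod L) ` (A \<inter> {m..<m + L}) \<subseteq> A \<inter> {0..<L}"
      using L 1 by auto
    show "(\<lambda>x. m + (x - m) mod L) ` (A \<inter> {0..<L}) \<subseteq> A \<inter> {m..<m + L}"
      using L 2 by (auto simp del: minus_mod_self2)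
  qed
  then show ?thesis by (rule bij_betw_same_card)
qed

lemma free_set_period:
  assumes "\<And>b. b \<in> B \<Longrightarrow> int b dvd L"
  shows "m + L \<in> free_set B \<longleftrightarrow> m \<in> free_set B"
  using assms by (auto simp: free_set_iff dvd_add_left_iff)

lemma prob_residue_shift:
  assumes per: "\<And>m. m + fact n \<in> A \<longleftrightarrow> m \<in> A"
  shows "measure haar {\<omega>. residue n \<omega> + s \<in> A} = measure haar {\<omega>. residue n \<omega> \<in> A}"
proof -
  have "bij_betw (\<lambda>x. x + s) ({m. m + s \<in> A} \<inter> {0..<fact n}) (A \<inter> {s..<s + fact n})"
    by (rule bij_betw_byWitness[where f' = "\<lambda>x. x - s"]) auto
  then have "card ({m. m + s \<in> A} \<inter> {0..<fact n}) = card (A \<inter> {s..<s + fact n})"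
    by (rule bij_betw_same_card)
  also have "\<dots> = card (A \<inter> {0..<fact n})"
    using per by (intro card_shift_period) auto
  finally show ?thesis
    using prob_residue[of n "{m. m + s \<in> A}"] prob_residue[of n A] by simp
qed

text \<open>The events are periodic, and a periodic set has equally many elements in any two windows whose
length is a period. This is the invariance of Haar measure under the translation by \<open>s\<close>.\<close>
lemma prob_sieve_shift_finite:
  assumes B: "finite B" "0 \<notin> B" and a: "0 < a"
  shows "measure haar (sieve B ((\<lambda>u. u + s) ` U) \<inter> {\<omega>. pdvd a s \<omega>})
       = measure haar (sieve B U \<inter> {\<omega>. pdvd a 0 \<omega>})"
proof -
  obtain n where n: "\<And>b. b \<in> insert a B \<Longrightarrow> b \<le> n"
    using B finite_nat_set_iff_bounded_le[of "insert a B"] by auto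
  have Bn: "0 < b \<and> b \<le> n" if "b \<in> B" for b
    using that n B by (auto intro: Nat.gr0I)
  let ?A = "{m. (\<forall>u\<in>U. m + u \<in> free_set B) \<and> int a dvd m}"
  have per: "m + fact n \<in> ?A \<longleftrightarrow> m \<in> ?A" for m
  proof -
    have "m + fact n + u \<in> free_set B \<longleftrightarrow> m + u \<in> free_set B" for u
      using free_set_period[of B "fact n" "m + u"] Bn int_dvd_fact by (simp add: algebra_simps)
    moreover have "int a dvd m + fact n \<longleftrightarrow> int a dvd m"
      using int_dvd_fact[of a n] a n by (simp add: dvd_add_left_iff)
    ultimately show ?thesis by simp
  qed
  have "sieve B ((\<lambda>u. u + s) ` U) \<inter> {\<omega>. pdvd a s \<omega>} = {\<omega>. residue n \<omega> + s \<in> ?A}"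
    using sieve_iff_free_set[of B n _ "(\<lambda>u. u + s) ` U"] Bn pdvd_iff[of a n s] a n 
    by (auto simp: algebra_simps)
  moreover have "sieve B U \<inter> {\<omega>. pdvd a 0 \<omega>} = {\<omega>. residue n \<omega> \<in> ?A}"
    using sieve_iff_free_set[of B n _ "U"] Bn pdvd_iff[of a n 0] a n by auto
  ultimately show ?thesis
    using prob_residue_shift[of n ?A s] per by simp
qed

lemma prob_sieve_shift:
  assumes "0 \<notin> B" "0 < a"
  shows "measure haar (sieve B ((\<lambda>u. u + s) ` U) \<inter> {\<omega>. pdvd a s \<omega>})
       = measure haar (sieve B U \<inter> {\<omega>. pdvd a 0 \<omega>})"
proof (rule LIMSEQ_unique)
  have "(\<lambda>n. measure haar (sieve (trunc B n) ((\<lambda>u. u + s) ` U) \<inter> {\<omega>. pdvd a s \<omega>}))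
      = (\<lambda>n. measure haar (sieve (trunc B n) U \<inter> {\<omega>. pdvd a 0 \<omega>}))"
    using assms trunc_subset[of B] by (intro ext prob_sieve_shift_finite) auto
  then show "(\<lambda>n. measure haar (sieve (trunc B n) U \<inter> {\<omega>. pdvd a 0 \<omega>}))
     \<longlonglongrightarrow> measure haar (sieve B ((\<lambda>u. u + s) ` U) \<inter> {\<omega>. pdvd a s \<omega>})"
    using sieve_trunc_LIMSEQ[of "{\<omega>. pdvd a s \<omega>}" B "(\<lambda>u. u + s) ` U"] by simp
  show "(\<lambda>n. measure haar (sieve (trunc B n) U \<inter> {\<omega>. pdvd a 0 \<omega>}))
     \<longlonglongrightarrow> measure haar (sieve B U \<inter> {\<omega>. pdvd a 0 \<omega>})"
    by (rule sieve_trunc_LIMSEQ) simp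
qed

lemma free_prob_shift:
  assumes "0 \<notin> B" shows "free_prob B ((\<lambda>u. u + s) ` U) = free_prob B U"
  using prob_sieve_shift[OF assms, of 1 s U] by (simp add: free_prob_def)

text \<open>By translation invariance the \<open>a\<close> residue classes modulo \<open>a\<close> have equal probability.\<close>
lemma prob_pdvd: 
  assumes "0 < a" shows "measure haar {\<omega>. pdvd a u \<omega>} = 1 / real a"
proof -
  have *: "measure haar {\<omega>. pdvd a (int s) \<omega>} = measure haar {\<omega>. pdvd a 0 \<omega>}" for s
    using prob_sieve_shift[of "{}" a "int s" "{}"] assms by (simp add: sieve_def)
  have "(\<Sum>s<a. measure haar {\<omega>. pdvd a (int s) \<omega>}) = measure haar (\<Union>s<a. {\<omega>. pdvd a (int s) \<omega>})"
  proof (rule haar.finite_measure_finite_Union[symmetric])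
    show "disjoint_family_on (\<lambda>s. {\<omega>. pdvd a (int s) \<omega>}) {..<a}"
    proof (unfold disjoint_family_on_def, intro ballI impI)
      fix s t assume st: "s \<in> {..<a}" "t \<in> {..<a}" "s \<noteq> t"
      have "\<not> (int a dvd x + int s \<and> int a dvd x + int t)" for x
      proof
        assume "int a dvd x + int s \<and> int a dvd x + int t"
        then have "int a dvd (x + int s) - (x + int t)" by (intro dvd_diff) auto
        then have "[int s = int t] (mod int a)" by (simp add: cong_iff_dvd_diff)
        then show False using st by (simp add: cong_def)
      qed
      then show "{\<omega>. pdvd a (int s) \<omega>} \<inter> {\<omega>. pdvd a (int t) \<omega>} = {}"
        by (auto simp: pdvd_def)
    qed
  qed auto
  also have "(\<Union>s<a. {\<omega>. pdvd a (int s) \<omega>}) = UNIV"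
  proof -
    have "\<exists>s<a. int a dvd x + int s" for x
      using assms by (intro exI[of _ "nat ((- x) mod int a)"])
        (auto simp: nat_less_iff dvd_eq_mod_eq_0 mod_add_right_eq)
    then show ?thesis by (auto simp: pdvd_def)
  qed
  finally have "real a * measure haar {\<omega>. pdvd a 0 \<omega>} = 1"
    using * haar.prob_space by simp
  moreover have "measure haar {\<omega>. pdvd a u \<omega>} = measure haar {\<omega>. pdvd a 0 \<omega>}"
    using prob_sieve_shift[of "{}" a u "{}"] assms by (simp add: sieve_def)
  ultimately show ?thesis using assms by (simp add: field_simps)
qed

section \<open>Multiples inside a sieved set\<close>

abbreviation free_density :: "nat set \<Rightarrow> real" where
  "free_density B \<equiv> free_prob B {0}"

lemma free_density_mult_prob: "free_density B = mult_prob B 1"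
  by (simp add: free_prob_def mult_prob_def)

lemma mult_prob_nonneg [simp]: "0 \<le> mult_prob B a"
  by (simp add: mult_prob_def)

lemma mult_prob_antimono: "B \<subseteq> C \<Longrightarrow> mult_prob C a \<le> mult_prob B a"
  unfolding mult_prob_def by (intro haar.finite_measure_mono Int_mono sieve_antimono) auto

lemma mult_prob_dvd: "a dvd b \<Longrightarrow> 0 < b \<Longrightarrow> mult_prob B b \<le> mult_prob B a"
  unfolding mult_prob_def by (intro haar.finite_measure_mono Int_mono) (auto intro: pdvd_mono)

lemma mult_prob_empty: "0 < a \<Longrightarrow> mult_prob {} a = 1 / real a"
  by (simp add: mult_prob_def sieve_def prob_pdvd)

text \<open>Together with \<open>mult_prob_empty\<close> this recursion determines \<open>mult_prob\<close> on finite sets of moduli: it is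
inclusion and exclusion in which the numbers \<open>1 / a\<close> are the only input. Identities for finite
sets, and the comparison with logarithmic densities, follow by induction over the set with \<open>a\<close>
arbitrary.\<close>
lemma mult_prob_insert:
  assumes "0 < k" "0 < a"
  shows "mult_prob (insert k B) a = mult_prob B a - mult_prob B (lcm a k)"
proof -
  have eq: "sieve (insert k B) {0} \<inter> {\<omega>. pdvd a 0 \<omega>}
      = (sieve B {0} \<inter> {\<omega>. pdvd a 0 \<omega>}) - (sieve B {0} \<inter> {\<omega>. pdvd (lcm a k) 0 \<omega>})"
    using pdvd_lcm[OF assms(2,1)] by (auto simp: sieve_def)
  show ?thesis unfolding mult_prob_def eq
    by (rule haar.finite_measure_Diff) (auto simp: pdvd_lcm assms)
qed

lemma div_pos_of_dvd: "(d::nat) dvd a \<Longrightarrow> 0 < a \<Longrightarrow> 0 < a div d"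
  by (auto simp: div_greater_zero_iff dvd_imp_le intro: dvd_pos_nat)

lemma lcm_mult_scale: "lcm (c * a) k = c * lcm a (k div gcd k c)" for a c k :: nat
proof -
  have "c * (k div gcd k c) = lcm c k"
    by (metis div_mult_swap gcd.commute gcd_dvd1 lcm_nat_def)
  then have "c * lcm a (k div gcd k c) = lcm (c * a) (lcm c k)"
    using lcm_mult_distrib'[of c a "k div gcd k c"] by simp
  also have "\<dots> = lcm (c * a) k"
    by (metis dvd_triv_left lcm.assoc lcm_proj1_if_dvd_nat)
  finally show ?thesis by simp
qed

lemma mult_prob_scale_finite:
  assumes "finite B" "0 \<notin> B" "0 < c" "0 < a"
  shows "real c * mult_prob B (c * a) = mult_prob ((\<lambda>k. k div gcd k c) ` B) a"
  using assms(1,2,4)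
proof (induction B arbitrary: a rule: finite_induct)
  case empty
  then show ?case using assms(3) by (simp add: mult_prob_empty)
next
  case (insert k B)
  let ?k = "k div gcd k c"
  have k: "0 < k" "0 < ?k" "0 \<notin> B"
    using insert.prems by (auto simp: div_pos_of_dvd intro!: Nat.gr0I)
  have "real c * mult_prob (insert k B) (c * a)
      = real c * mult_prob B (c * a) - real c * mult_prob B (c * lcm a ?k)"
    using k insert.prems assms(3) by (simp add: mult_prob_insert lcm_mult_scale right_diff_distrib)
  also have "\<dots> = mult_prob ((\<lambda>k. k div gcd k c) ` B) a - mult_prob ((\<lambda>k. k div gcd k c) ` B) (lcm a ?k)"
    using insert.IH[of a] insert.IH[of "lcm a ?k"] k insert.prems by (simp add: lcm_pos_nat)
  also have "\<dots> = mult_prob ((\<lambda>k. k div gcd k c) ` insert k B) a"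
    using k insert.prems by (simp add: mult_prob_insert)
  finally show ?case .
qed

lemma mult_prob_LIMSEQ:
  assumes "\<And>n. K n \<subseteq> K (Suc n)" "(\<Union>n. K n) = B"
  shows "(\<lambda>n. mult_prob (K n) a) \<longlonglongrightarrow> mult_prob B a"
  unfolding mult_prob_def using assms by (intro sieve_LIMSEQ) auto

text \<open>Substitute \<open>\<omega> = c * \<omega>'\<close>: the number \<open>k\<close> divides \<open>c * \<omega>'\<close> if and only if \<open>k div gcd k c\<close> divides \<open>\<omega>'\<close>.\<close>
lemma mult_prob_scale:
  assumes "0 \<notin> B" "0 < c" "0 < a"
  shows "real c * mult_prob B (c * a) = mult_prob ((\<lambda>k. k div gcd k c) ` B) a"
proof (rule LIMSEQ_unique)
  let ?r = "\<lambda>k. k div gcd k c"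
  show "(\<lambda>n. mult_prob (?r ` trunc B n) a) \<longlonglongrightarrow> mult_prob (?r ` B) a"
    by (rule mult_prob_LIMSEQ) (auto simp: trunc_def)
  have "(\<lambda>n. real c * mult_prob (trunc B n) (c * a)) \<longlonglongrightarrow> real c * mult_prob B (c * a)"
    by (intro tendsto_mult_left mult_prob_LIMSEQ) (auto simp: trunc_def)
  moreover have "real c * mult_prob (trunc B n) (c * a) = mult_prob (?r ` trunc B n) a" for n
    using assms trunc_subset[of B] by (intro mult_prob_scale_finite) auto
  ultimately show "(\<lambda>n. mult_prob (?r ` trunc B n) a) \<longlonglongrightarrow> real c * mult_prob B (c * a)"
    by simp
qed

lemma mult_prob_coprime:
  assumes "0 \<notin> B" "0 < c" "\<And>b. b \<in> B \<Longrightarrow> coprime b c"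
  shows "mult_prob B c = free_density B / c"
proof -
  have "(\<lambda>k. k div gcd k c) ` B = (\<lambda>k. k) ` B"
    using assms(3) by (intro image_cong) auto
  then show ?thesis
    using mult_prob_scale[of B c 1] assms by (simp add: free_density_mult_prob field_simps)
qed

lemma free_density_empty [simp]: "free_density {} = 1"
  by (simp add: free_density_mult_prob mult_prob_empty)

lemma free_density_singleton: "0 < x \<Longrightarrow> free_density {x} = 1 - 1 / x"
  unfolding free_density_mult_prob by (subst mult_prob_insert) (simp_all add: mult_prob_empty)

lemma free_density_has_1: "1 \<in> B \<Longrightarrow> free_density B = 0"
proof -
  assume "1 \<in> B"
  then have "sieve B {0} = {}" by (auto simp: sieve_def intro!: bexI[of _ 1])
  then show ?thesis by (simp add: free_prob_def)
qed

section \<open>Behrend's inequality\<close>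

text \<open>Two antitone functions of one random variable are positively correlated: the double sum of
\<open>w i * w j * ((x i - x j) * (y i - y j))\<close> has nonnegative terms.\<close>
lemma weighted_chebyshev:
  fixes w x y :: "nat \<Rightarrow> real"
  assumes w: "\<And>i. 0 \<le> w i" "sum w I = 1" and x: "antimono x" and y: "antimono y"
  shows "(\<Sum>i\<in>I. w i * x i) * (\<Sum>i\<in>I. w i * y i) \<le> (\<Sum>i\<in>I. w i * (x i * y i))"
proof -
  have "0 \<le> (\<Sum>i\<in>I. \<Sum>j\<in>I. w i * w j * ((x i - x j) * (y i - y j)))"
  proof (intro sum_nonneg)
    fix i j
    have "0 \<le> (x i - x j) * (y i - y j)"
      using antimonoD[OF x, of i j] antimonoD[OF x, of j i] antimonoD[OF y, of i j]
        antimonoD[OF y, of j i] linear[of i j] by (auto intro: mult_nonneg_nonneg mult_nonpos_nonpos)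
    then show "0 \<le> w i * w j * ((x i - x j) * (y i - y j))" by (simp add: w)
  qed
  also have "\<dots> = (\<Sum>i\<in>I. \<Sum>j\<in>I. (w i * (x i * y i)) * w j - (w i * x i) * (w j * y j)
       - (w i * y i) * (w j * x j) + w i * (w j * (x j * y j)))"
    by (intro sum.cong refl) (simp add: algebra_simps)
  also have "\<dots> = 2 * (sum w I * (\<Sum>i\<in>I. w i * (x i * y i)) - (\<Sum>i\<in>I. w i * x i) * (\<Sum>i\<in>I. w i * y i))"
    by (simp only: sum.distrib sum_subtractf sum_product[symmetric]) (simp add: algebra_simps)
  finally show ?thesis using w by simp
qed

text \<open>The sieving conditions that remain active, stripped of the prime \<open>p\<close>, when the valuation of \<open>\<omega>\<close> at
\<open>p\<close> is exactly \<open>j\<close>.\<close>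
definition fiber :: "nat \<Rightarrow> nat \<Rightarrow> nat set \<Rightarrow> nat set" where
  "fiber p j A = (\<lambda>a. a div p ^ multiplicity p a) ` {a\<in>A. multiplicity p a \<le> j}"

lemma fiber_props:
  assumes "prime p" "0 \<notin> A" "c \<in> fiber p j A"
  shows "0 < c" "coprime c p" "\<exists>a\<in>A. prime_factors c \<subseteq> prime_factors a - {p}"
proof -
  obtain a where a: "a \<in> A" "c = a div p ^ multiplicity p a"
    using assms(3) by (auto simp: fiber_def)
  have a0: "a \<noteq> 0" using a assms by metis
  show c: "0 < c" using a a0 by (simp add: div_pos_of_dvd multiplicity_dvd)
  have np: "\<not> p dvd c" using a a0 assms(1)
    by (metis multiplicity_decompose not_prime_unit)
  then show "coprime c p"
    using assms(1) by (metis coprime_commute prime_imp_coprime)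
  have "c dvd a" using a by (metis dvd_div_mult_self dvd_triv_left multiplicity_dvd)
  then have "prime_factors c \<subseteq> prime_factors a"
    using a0 by (simp add: dvd_prime_factors)
  then show "\<exists>a\<in>A. prime_factors c \<subseteq> prime_factors a - {p}"
    using a np by (auto simp: prime_factors_dvd)
qed

text \<open>Condition on the valuation of \<open>\<omega>\<close> at \<open>p\<close>, all valuations from \<open>J\<close> on being lumped together. The valuation
is independent of divisibility by numbers prime to \<open>p\<close>.\<close>
lemma free_density_fiber_decomp:
  assumes p: "prime p" and A: "finite A" "0 \<notin> A" and J: "\<And>a. a \<in> A \<Longrightarrow> multiplicity p a \<le> J"
  shows "free_density A = (\<Sum>j\<le>J. (if j < J then 1 / p ^ j - 1 / p ^ Suc j else 1 / p ^ J)
            * free_density (fiber p j A))"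
proof -
  have p0: "0 < p ^ j" for j using p prime_gt_0_nat by auto
  have fib: "mult_prob (fiber p j A) (p ^ i) = free_density (fiber p j A) / p ^ i" for i j
    using fiber_props[OF p A(2)] p0 by (subst mult_prob_coprime) (auto simp: coprime_power_right_iff)
  have G: "mult_prob A (p ^ j) - mult_prob A (p ^ Suc j)
      = (1 / p ^ j - 1 / p ^ Suc j) * free_density (fiber p j A)" for j
  proof -
    have lcm: "lcm (p ^ j) (p ^ Suc j) = p ^ Suc j"
      by (intro lcm_proj2_if_dvd_nat le_imp_power_dvd) simp
    have ins: "mult_prob (insert (p ^ Suc j) X) (p ^ j) = mult_prob X (p ^ j) - mult_prob X (p ^ Suc j)" for X
      using mult_prob_insert[of "p ^ Suc j" "p ^ j" X] p0 lcm by metis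
    \<comment> \<open>On the event that the valuation of \<omega> is j, divisibility by a splits at the prime p.\<close>
    have key: "pdvd a 0 \<omega> \<longleftrightarrow> multiplicity p a \<le> j \<and> pdvd (a div p ^ multiplicity p a) 0 \<omega>"
      if a: "a \<in> A" and w: "pdvd (p ^ j) 0 \<omega>" "\<not> pdvd (p ^ Suc j) 0 \<omega>" for a \<omega>
    proof -
      let ?v = "multiplicity p a"
      let ?c = "a div p ^ ?v"
      have a0: "a > 0" using a A by (auto intro: Nat.gr0I)
      have dec: "a = p ^ ?v * ?c" by (simp add: multiplicity_dvd)
      have c0: "0 < ?c" using a0 by (simp add: div_pos_of_dvd multiplicity_dvd)
      have "\<not> p dvd ?c" using a0 p by (metis multiplicity_decompose not_prime_unit gr_implies_not_zero)
      then have cop: "coprime (p ^ ?v) ?c"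
        using p by (simp add: prime_imp_coprime)
      then have "a = lcm (p ^ ?v) ?c" using dec by (simp add: lcm_coprime)
      then have iff: "pdvd a 0 \<omega> \<longleftrightarrow> pdvd (p ^ ?v) 0 \<omega> \<and> pdvd ?c 0 \<omega>"
        using pdvd_lcm[OF p0 c0, of ?v 0 \<omega>] by simp
      have "pdvd (p ^ ?v) 0 \<omega> \<longleftrightarrow> ?v \<le> j"
        using w pdvd_mono[of "p ^ ?v" "p ^ j" 0 \<omega>] pdvd_mono[of "p ^ Suc j" "p ^ ?v" 0 \<omega>] p0
          le_imp_power_dvd[of ?v j p] le_imp_power_dvd[of "Suc j" ?v p] by (meson not_less_eq_eq)
      then show ?thesis using iff by simp
    qed
    have "sieve (insert (p ^ Suc j) A) {0} \<inter> {\<omega>. pdvd (p ^ j) 0 \<omega>}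
        = sieve (insert (p ^ Suc j) (fiber p j A)) {0} \<inter> {\<omega>. pdvd (p ^ j) 0 \<omega>}"
      unfolding sieve_def fiber_def using key by (auto simp del: power_Suc)
    then have "mult_prob (insert (p ^ Suc j) A) (p ^ j) = mult_prob (insert (p ^ Suc j) (fiber p j A)) (p ^ j)"
      by (simp add: mult_prob_def)
    then show ?thesis using ins fib by (simp add: left_diff_distrib del: power_Suc)
  qed
  have top: "mult_prob A (p ^ J) = 1 / p ^ J * free_density (fiber p J A)"
  proof -
    have "a div gcd a (p ^ J) = a div p ^ multiplicity p a" if a: "a \<in> A" for a
    proof -
      have a0: "a \<noteq> 0" using a A by metis
      have np: "\<not> p dvd a div p ^ multiplicity p a"
        using a0 p by (metis multiplicity_decompose not_prime_unit)
      have "gcd a (p ^ J) = p ^ multiplicity p a"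
      proof (rule gcd_unique_nat[THEN iffD1, symmetric], intro conjI allI impI)
        show "p ^ multiplicity p a dvd a" by (rule multiplicity_dvd)
        show "p ^ multiplicity p a dvd p ^ J" using J[OF a] by (rule le_imp_power_dvd)
        fix e assume e: "e dvd a \<and> e dvd p ^ J"
        then obtain i where i: "e = p ^ i" using p by (auto simp: divides_primepow_nat)
        then show "e dvd p ^ multiplicity p a"
          using e a0 p by (metis le_imp_power_dvd not_prime_unit multiplicity_geI)
      qed
      then show ?thesis by simp
    qed
    then have "(\<lambda>a. a div gcd a (p ^ J)) ` A = fiber p J A"
      using J by (auto simp: fiber_def intro!: image_cong)
    then show ?thesis
      using mult_prob_scale[OF A(2) p0[of J], of 1] p0[of J]
      by (simp add: free_density_mult_prob field_simps)
  qed
  have tel: "mult_prob A 1 = (\<Sum>j<n. mult_prob A (p ^ j) - mult_prob A (p ^ Suc j)) + mult_prob A (p ^ n)" for n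
    by (induction n) auto
  show ?thesis
    unfolding free_density_mult_prob[of A] tel[of J] G top
    by (simp add: lessThan_Suc_atMost[symmetric] del: power_Suc)
qed

text \<open>The probability of being sieved is a mean over the valuation at \<open>p\<close> of probabilities that do not
involve \<open>p\<close> any more and decrease in the valuation. So Chebyshev's inequality reduces the claim to
fewer primes.\<close>
lemma behrend_finite:
  assumes "finite P" "\<And>p. p \<in> P \<Longrightarrow> prime p" "finite A" "finite C" "0 \<notin> A \<union> C"
    and "\<And>a. a \<in> A \<union> C \<Longrightarrow> prime_factors a \<subseteq> P"
  shows "free_density A * free_density C \<le> free_density (A \<union> C)"
  using assms
proof (induction P arbitrary: A C rule: finite_induct)
  case empty
  have *: "a = 1" if "a \<in> A \<union> C" for a
    using empty(5)[OF that] empty(4) that prime_factorization_empty_iff[of a] by auto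
  show ?case
  proof (cases "A \<union> C = {}")
    case False
    then have "1 \<in> A \<or> 1 \<in> C" using * by auto
    then show ?thesis using free_density_has_1[of A] free_density_has_1[of C] by auto
  qed auto
next
  case (insert p P)
  have p: "prime p" using insert.prems by simp
  define J where "J = Max (insert 0 (multiplicity p ` (A \<union> C)))"
  have J: "multiplicity p a \<le> J" if "a \<in> A \<union> C" for a
    unfolding J_def using that insert.prems by (intro Max_ge) auto
  define w where "w j = (if j < J then 1 / real p ^ j - 1 / real p ^ Suc j else 1 / real p ^ J)" for j
  have dec: "free_density X = (\<Sum>j\<le>J. w j * free_density (fiber p j X))" if "X \<subseteq> A \<union> C" for X
    unfolding w_def using free_density_fiber_decomp[OF p, of X J] that J insert.prems
    by (auto intro: finite_subset)
  have wnn: "0 \<le> w j" for j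
    using prime_gt_0_nat[OF p] by (simp add: w_def divide_simps)
  \<comment> \<open>The decomposition of the empty set, whose density is 1, shows that the weights sum to 1.\<close>
  have w1: "sum w {..J} = 1"
    using dec[of "{}"] by (simp add: fiber_def)
  have anti: "antimono (\<lambda>j. free_density (fiber p j X))" for X
    by (rule antimonoI, rule free_prob_antimono) (auto simp: fiber_def)
  have un: "fiber p j (A \<union> C) = fiber p j A \<union> fiber p j C" for j
    by (auto simp: fiber_def)
  have "free_density A * free_density C
     = (\<Sum>j\<le>J. w j * free_density (fiber p j A)) * (\<Sum>j\<le>J. w j * free_density (fiber p j C))"
    using dec[of A] dec[of C] by simp
  also have "\<dots> \<le> (\<Sum>j\<le>J. w j * (free_density (fiber p j A) * free_density (fiber p j C)))"
    by (rule weighted_chebyshev[OF wnn w1 anti anti])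
  also have "\<dots> \<le> (\<Sum>j\<le>J. w j * free_density (fiber p j (A \<union> C)))"
  proof (intro sum_mono mult_left_mono wnn)
    fix j
    have "free_density (fiber p j A) * free_density (fiber p j C)
        \<le> free_density (fiber p j A \<union> fiber p j C)"
    proof (rule insert.IH)
      show "finite (fiber p j A)" "finite (fiber p j C)"
        using insert.prems by (auto simp: fiber_def)
      show "0 \<notin> fiber p j A \<union> fiber p j C"
        using fiber_props(1)[OF p insert.prems(4), of 0 j] un by auto
      show "prime_factors a \<subseteq> P" if "a \<in> fiber p j A \<union> fiber p j C" for a
        using fiber_props(3)[OF p insert.prems(4), of a j] that un insert.prems(5) by blast
    qed (use insert.prems in auto)
    then show "free_density (fiber p j A) * free_density (fiber p j C) \<le> free_density (fiber p j (A \<union> C))"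
      by (simp add: un)
  qed
  also have "\<dots> = free_density (A \<union> C)" using dec[of "A \<union> C"] by simp
  finally show ?case .
qed

lemma behrend:
  assumes "0 \<notin> A" "0 \<notin> C"
  shows "free_density A * free_density C \<le> free_density (A \<union> C)"
proof (rule LIMSEQ_le)
  show "(\<lambda>n. free_density (trunc A n) * free_density (trunc C n)) \<longlonglongrightarrow> free_density A * free_density C"
    by (intro tendsto_mult free_prob_trunc)
  show "(\<lambda>n. free_density (trunc (A \<union> C) n)) \<longlonglongrightarrow> free_density (A \<union> C)"
    by (rule free_prob_trunc)
  have "free_density (trunc A n) * free_density (trunc C n) \<le> free_density (trunc (A \<union> C) n)" for n
  proof -
    have "trunc (A \<union> C) n = trunc A n \<union> trunc C n" by (auto simp: trunc_def)
    moreover have "free_density (trunc A n) * free_density (trunc C n) \<le> free_density (trunc A n \<union> trunc C n)"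
      using assms trunc_subset by (intro behrend_finite[of "\<Union>a\<in>trunc A n \<union> trunc C n. prime_factors a"]) auto
    ultimately show ?thesis by simp
  qed
  then show "\<exists>N. \<forall>n\<ge>N. free_density (trunc A n) * free_density (trunc C n) \<le> free_density (trunc (A \<union> C) n)"
    by blast
qed

lemma behrend_UN_zero:
  assumes "finite I" "\<And>i. i \<in> I \<Longrightarrow> 0 \<notin> A i" "free_density (\<Union>i\<in>I. A i) = 0"
  shows "\<exists>i\<in>I. free_density (A i) = 0"
  using assms
proof (induction I rule: finite_induct)
  case (insert i I)
  have "free_density (A i) * free_density (\<Union>i\<in>I. A i) \<le> 0"
    using behrend[of "A i" "\<Union>i\<in>I. A i"] insert.prems by simp
  then have "free_density (A i) = 0 \<or> free_density (\<Union>i\<in>I. A i) = 0"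
    by (metis free_prob_nonneg mult_eq_0_iff mult_nonneg_nonneg order_antisym)
  then show ?case using insert by auto
qed simp

text \<open>If almost every multiple of \<open>b\<close> is a multiple of \<open>C\<close>, then after division by \<open>b\<close> the moduli
\<open>c div gcd c b\<close> sieve out almost everything. They split into finitely many families according to the
value of the gcd, and by Behrend's inequality a single family does this already.\<close>
lemma null_multiples_divisor:
  assumes "0 \<notin> C" "0 < b" "mult_prob C b = 0"
  obtains d where "d dvd b" "free_density ((\<lambda>c. c div d) ` {c\<in>C. gcd c b = d}) = 0"
proof -
  have "(\<lambda>c. c div gcd c b) ` C = (\<Union>d\<in>{d. d dvd b}. (\<lambda>c. c div d) ` {c\<in>C. gcd c b = d})"
    by auto
  then have "free_density (\<Union>d\<in>{d. d dvd b}. (\<lambda>c. c div d) ` {c\<in>C. gcd c b = d}) = 0"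
    using mult_prob_scale[of C b 1] assms by (simp add: free_density_mult_prob)
  moreover have "0 \<notin> (\<lambda>c. c div d) ` {c\<in>C. gcd c b = d}" if "d dvd b" for d
    using assms by (auto simp: div_eq_0_iff dvd_imp_le) (metis dvd_imp_le gcd_dvd1 gr0I not_le)
  ultimately show ?thesis
    using behrend_UN_zero[of "{d. d dvd b}" "\<lambda>d. (\<lambda>c. c div d) ` {c\<in>C. gcd c b = d}"] assms that
    by fastforce
qed

lemma mult_prob_common_divisor:
  assumes "0 \<notin> C" "0 < d" "\<And>c. c \<in> C \<Longrightarrow> d dvd c"
  shows "real d * mult_prob C d = free_density ((\<lambda>c. c div d) ` C)"
proof -
  have "(\<lambda>c. c div gcd c d) ` C = (\<lambda>c. c div d) ` C"
    using assms(3) by (intro image_cong) (auto simp: gcd_proj2_if_dvd_nat)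
  then show ?thesis using mult_prob_scale[of C d 1] assms by (simp add: free_density_mult_prob)
qed

abbreviation primes_upto :: "nat \<Rightarrow> nat set" where
  "primes_upto N \<equiv> {p. prime p \<and> p \<le> N}"

section \<open>A lower bound of Mertens type\<close>

text \<open>Each new prime removes a proportion of \<open>1 / p\<close> of what is left.\<close>
lemma free_density_primes:
  assumes "finite Q" "\<And>p. p \<in> Q \<Longrightarrow> prime p"
  shows "free_density Q = (\<Prod>p\<in>Q. 1 - 1 / real p)"
  using assms
proof (induction Q rule: finite_induct)
  case (insert p Q)
  have p: "0 < p" using insert.prems prime_gt_0_nat by blast
  have "free_density (insert p Q) = free_density Q - mult_prob Q p"
    using p by (simp add: free_density_mult_prob mult_prob_insert)
  also have "mult_prob Q p = free_density Q / p"
  proof (rule mult_prob_coprime)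
    show "0 \<notin> Q" using insert.prems by (metis insertCI not_prime_0)
    show "coprime b p" if "b \<in> Q" for b
      using that insert.prems insert.hyps by (intro primes_coprime) auto
  qed (rule p)
  finally show ?case using insert by (simp add: algebra_simps)
qed simp

text \<open>One Euler factor at a time: the multiples of \<open>p\<close> contribute \<open>p powr - s\<close> times the series over the
integers that are prime to the earlier primes.\<close>
lemma coprime_zeta_sums:
  fixes s :: real
  assumes "finite Q" "\<And>p. p \<in> Q \<Longrightarrow> prime p" "(\<lambda>n. real n powr - s) sums z"
  shows "(\<lambda>n. if \<forall>p\<in>Q. \<not> p dvd n then real n powr - s else 0) sums (z * (\<Prod>p\<in>Q. 1 - real p powr - s))"
  using assms(1,2)
proof (induction Q rule: finite_induct)
  case empty
  then show ?case using assms(3) by simp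
next
  case (insert p Q)
  let ?g = "\<lambda>Q n. if \<forall>p\<in>Q. \<not> p dvd n then real n powr - s else 0"
  let ?z = "z * (\<Prod>p\<in>Q. 1 - real p powr - s)"
  have p: "prime p" and p0: "0 < p" using insert.prems prime_gt_0_nat by auto
  have IH: "?g Q sums ?z" using insert by simp
  have dvd: "q dvd p * m \<longleftrightarrow> q dvd m" if "q \<in> Q" for q m
    using that insert.prems insert.hyps p
    by (metis coprime_commute coprime_dvd_mult_right_iff insertCI primes_coprime)
  have "(\<lambda>m. if p dvd p * m then ?g Q (p * m) else 0) = (\<lambda>m. real p powr - s * ?g Q m)"
    by (auto simp: fun_eq_iff dvd powr_mult)
  then have "(\<lambda>m. if p dvd p * m then ?g Q (p * m) else 0) sums (real p powr - s * ?z)"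
    using sums_mult[OF IH, of "real p powr - s"] by simp
  then have "(\<lambda>n. if p dvd n then ?g Q n else 0) sums (real p powr - s * ?z)"
    using p0 by (subst (asm) sums_mono_reindex[where g = "\<lambda>m. p * m"]) (auto simp: strict_mono_def)
  from sums_diff[OF IH this]
  have "(\<lambda>n. ?g Q n - (if p dvd n then ?g Q n else 0)) sums (?z - real p powr - s * ?z)" .
  moreover have "(\<lambda>n. ?g Q n - (if p dvd n then ?g Q n else 0)) = ?g (insert p Q)"
    by (auto simp: fun_eq_iff)
  moreover have "?z - real p powr - s * ?z = z * (\<Prod>p\<in>insert p Q. 1 - real p powr - s)"
    using insert.hyps by (simp add: algebra_simps)
  ultimately show ?case by simp
qed

text \<open>The terms are bounded by the differences of the telescoping sequence \<open>n powr - t / t\<close>.\<close>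
lemma zeta_bound:
  fixes t :: real
  assumes t: "0 < t"
  shows "\<exists>z. (\<lambda>n. real n powr - (1 + t)) sums z \<and> z \<le> 1 + 1 / t"
proof -
  have step: "real (Suc n) powr - (1 + t) \<le> (real n powr - t - real (Suc n) powr - t) / t" if "0 < n" for n
  proof -
    let ?N = "real (Suc n)"
    have "ln (real n / ?N) \<le> real n / ?N - 1" using that by (intro ln_le_minus_one) simp
    then have "1 / ?N \<le> - ln (real n / ?N)" by (simp add: field_simps)
    then have "t * (1 / ?N) \<le> t * - ln (real n / ?N)" using t by (intro mult_left_mono) auto
    then have "1 + t / ?N \<le> 1 + t * - ln (real n / ?N)" by simp
    also have "\<dots> \<le> exp (t * - ln (real n / ?N))" by (rule exp_ge_add_one_self)
    also have "\<dots> = real n powr - t / ?N powr - t"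
      using that by (simp add: powr_def ln_div exp_diff[symmetric] algebra_simps)
    finally have "(1 + t / ?N) * ?N powr - t \<le> real n powr - t"
      by (simp add: field_simps del: of_nat_Suc)
    moreover have "?N powr - (1 + t) = ?N powr - t / ?N"
      by (simp add: powr_diff powr_minus algebra_simps powr_add divide_simps del: of_nat_Suc)
    ultimately show ?thesis
      using t by (simp add: pos_le_divide_eq distrib_left mult.commute del: of_nat_Suc)
  qed
  have part: "(\<Sum>n<Suc (Suc m). real n powr - (1 + t)) \<le> 1 + (1 - real (Suc m) powr - t) / t" for m
  proof (induction m)
    case (Suc m)
    have "(\<Sum>n<Suc (Suc (Suc m)). real n powr - (1 + t))
       \<le> 1 + (1 - real (Suc m) powr - t) / t + (real (Suc m) powr - t - real (Suc (Suc m)) powr - t) / t"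
      using Suc step[of "Suc m"] by (simp only: sum.lessThan_Suc) linarith
    then show ?case by (simp add: add_divide_distrib[symmetric] add.assoc del: of_nat_Suc sum.lessThan_Suc)
  qed simp
  have summ: "summable (\<lambda>n. real n powr - (1 + t))"
    using t by (subst summable_real_powr_iff) auto
  have "suminf (\<lambda>n. real n powr - (1 + t)) \<le> 1 + 1 / t"
  proof (rule suminf_le_const[OF summ])
    fix N
    have "(\<Sum>n<N. real n powr - (1 + t)) \<le> (\<Sum>n<Suc (Suc N). real n powr - (1 + t))"
      by (intro sum_mono2) auto
    also have "\<dots> \<le> 1 + (1 - real (Suc N) powr - t) / t" by (rule part)
    also have "\<dots> \<le> 1 + 1 / t" using t by (simp add: divide_right_mono)
    finally show "(\<Sum>n<N. real n powr - (1 + t)) \<le> 1 + 1 / t" .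
  qed
  then show ?thesis using summable_sums[OF summ] by blast
qed

lemma prime_power_dvd_fact: "0 < p \<Longrightarrow> p ^ k dvd (fact (p * k) :: nat)"
proof (induction k)
  case (Suc k)
  have "p ^ k dvd (fact (p * k + (p - 1)) :: nat)"
    using Suc fact_dvd[of "p * k" "p * k + (p - 1)"] by (meson dvd_trans le_add1)
  then have "p * p ^ k dvd (p * Suc k) * (fact (p * k + (p - 1)) :: nat)"
    by (intro mult_dvd_mono) auto
  also have eq: "p * Suc k = Suc (p * k + (p - 1))" using Suc.prems by simp
  have "(p * Suc k) * (fact (p * k + (p - 1)) :: nat) = fact (p * Suc k)"
    unfolding eq by simp
  finally show ?case by simp
qed simp

lemma prod_primes_dvd_fact:
  assumes "finite Q" "\<And>p. p \<in> Q \<Longrightarrow> prime p"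
  shows "(\<Prod>p\<in>Q. p ^ (N div p)) dvd (fact N :: nat)"
  using assms
proof (induction Q rule: finite_induct)
  case (insert p Q)
  have p: "prime p" "0 < p" using insert.prems prime_gt_0_nat by auto
  have "p ^ (N div p) dvd (fact (p * (N div p)) :: nat)" by (rule prime_power_dvd_fact) fact
  also have "\<dots> dvd fact N" by (rule fact_dvd) simp
  finally have 1: "p ^ (N div p) dvd (fact N :: nat)" .
  have "coprime (p ^ (N div p)) (\<Prod>p\<in>Q. p ^ (N div p))"
  proof (rule prod_coprime_right)
    fix q assume "q \<in> Q"
    then have "coprime p q" using insert.prems insert.hyps p by (intro primes_coprime) auto
    then show "coprime (p ^ (N div p)) (q ^ (N div q))" by simp
  qed
  then show ?case using 1 insert by (simp add: divides_mult)
qed simp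

lemma le_mult_Suc_div:
  assumes "0 < a" shows "real N \<le> real a * (real (N div a) + 1)"
proof -
  have "N \<le> a * (N div a + 1)"
    using dividend_less_times_div[OF assms, of N] by simp
  then have "real N \<le> real (a * (N div a + 1))" by (rule of_nat_mono)
  then show ?thesis by (simp add: distrib_left)
qed

text \<open>Take logarithms in the divisibility of \<open>N!\<close> by the product of the powers \<open>p ^ (N div p)\<close>. Replacing
\<open>N div p\<close> by \<open>N / p\<close> costs at most the sum of the numbers \<open>ln p\<close>, for which the trivial bound
\<open>N * ln N\<close> suffices because constants do not matter here.\<close>
lemma sum_ln_prime_over_prime:
  assumes "1 \<le> N"
  shows "(\<Sum>p\<in>primes_upto N. ln (real p) / real p) \<le> 2 * ln (real N)"
proof -
  let ?Q = "primes_upto N"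
  have pos: "1 < p" if "p \<in> ?Q" for p using that prime_gt_1_nat by blast
  have "(\<Sum>p\<in>?Q. real (N div p) * ln (real p)) = ln (real (\<Prod>p\<in>?Q. p ^ (N div p)))"
  proof -
    have "ln (\<Prod>p\<in>?Q. real (p ^ (N div p))) = (\<Sum>p\<in>?Q. ln (real (p ^ (N div p))))"
      by (intro ln_prod) (simp_all add: prime_gt_0_nat)
    also have "\<dots> = (\<Sum>p\<in>?Q. real (N div p) * ln (real p))"
      by (intro sum.cong refl) (simp add: ln_realpow prime_gt_0_nat)
    finally show ?thesis by simp
  qed
  also have "\<dots> \<le> ln (real (fact N))"
  proof -
    have "(\<Prod>p\<in>?Q. p ^ (N div p)) \<le> fact N"
      by (intro dvd_imp_le prod_primes_dvd_fact) auto
    moreover have "0 < (\<Prod>p\<in>?Q. p ^ (N div p))" by (intro prod_pos) (simp add: prime_gt_0_nat)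
    ultimately show ?thesis by (subst ln_le_cancel_iff) (auto simp del: of_nat_prod of_nat_fact)
  qed
  also have "\<dots> \<le> ln (real N ^ N)"
    using fact_le_power[of N, where ?'a = real] assms by (subst ln_le_cancel_iff) auto
  also have "\<dots> = real N * ln N" using assms by (simp add: ln_realpow)
  finally have 1: "(\<Sum>p\<in>?Q. real (N div p) * ln (real p)) \<le> real N * ln N" .
  have 2: "(\<Sum>p\<in>?Q. ln (real p)) \<le> real N * ln N"
  proof -
    have "(\<Sum>p\<in>?Q. ln (real p)) \<le> (\<Sum>p\<in>{1..N}. ln (real N))"
    proof (rule order_trans)
      show "(\<Sum>p\<in>?Q. ln (real p)) \<le> (\<Sum>p\<in>?Q. ln (real N))"
        by (intro sum_mono ln_mono) (auto simp: prime_gt_0_nat)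
      show "(\<Sum>p\<in>?Q. ln (real N)) \<le> (\<Sum>p\<in>{1..N}. ln (real N))"
        using assms by (intro sum_mono2) (auto simp: Suc_le_eq prime_gt_0_nat)
    qed
    then show ?thesis by simp
  qed
  have "real N * (\<Sum>p\<in>?Q. ln (real p) / real p) = (\<Sum>p\<in>?Q. real N / real p * ln (real p))"
    by (simp add: sum_distrib_left)
  also have "\<dots> \<le> (\<Sum>p\<in>?Q. (real (N div p) + 1) * ln (real p))"
  proof (intro sum_mono mult_right_mono)
    fix p assume p: "p \<in> ?Q"
    then show "0 \<le> ln (real p)" using pos[OF p] by simp
    show "real N / real p \<le> real (N div p) + 1"
      using le_mult_Suc_div[of p N] pos[OF p] by (simp add: field_simps)
  qed
  also have "\<dots> = (\<Sum>p\<in>?Q. real (N div p) * ln (real p)) + (\<Sum>p\<in>?Q. ln (real p))"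
    by (simp add: sum.distrib algebra_simps)
  also have "\<dots> \<le> real N * (2 * ln N)" using 1 2 by simp
  finally show ?thesis using assms by (subst (asm) mult_le_cancel_left_pos) auto
qed

text \<open>For \<open>s = 1 + 1 / ln N\<close> the term \<open>n = 1\<close> alone shows that the zeta series restricted to integers without
prime factors up to \<open>N\<close> is at least 1, so \<open>(1 + ln N) * (\<Prod> (1 - p powr - s)) \<ge> 1\<close>. Passing from
the exponent \<open>s\<close> to the exponent 1 costs a factor that is bounded because the sum of \<open>ln p / p\<close> is at
most \<open>2 * ln N\<close>.\<close>
lemma mertens_lower:
  assumes N: "2 \<le> N"
  shows "1 \<le> exp 4 * (1 + ln (real N)) * free_density (primes_upto N)"
proof -
  let ?Q = "primes_upto N"
  define t where "t = 1 / ln (real N)"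
  have lnN: "0 < ln (real N)" using N by simp
  have t: "0 < t" using lnN by (simp add: t_def)
  obtain z where z: "(\<lambda>n. real n powr - (1 + t)) sums z" "z \<le> 1 + ln (real N)"
    using zeta_bound[OF t] by (auto simp: t_def)
  let ?P = "\<Prod>p\<in>?Q. 1 - real p powr - (1 + t)"
  have p2: "2 \<le> p" if "p \<in> ?Q" for p using that prime_ge_2_nat by auto
  have le1: "real p powr - (1 + t) \<le> 1" if "p \<in> ?Q" for p
    using p2[OF that] t powr_mono[of "- (1 + t)" 0 "real p"] by auto
  have Ppos: "0 \<le> ?P" using le1 by (intro prod_nonneg) auto
  let ?g = "\<lambda>n. if \<forall>p\<in>?Q. \<not> p dvd n then real n powr - (1 + t) else 0"
  have g: "?g sums (z * ?P)"
    using z by (intro coprime_zeta_sums) auto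
  have "?g 1 \<le> z * ?P"
  proof -
    have "sum ?g {1} \<le> suminf ?g"
      using g by (intro sum_le_suminf) (auto simp: sums_iff)
    then show ?thesis using g by (simp add: sums_iff)
  qed
  moreover have "?g 1 = 1" by (auto dest: p2)
  ultimately have 1: "1 \<le> z * ?P" by simp
  have "?P \<le> (\<Prod>p\<in>?Q. (1 - 1 / real p) * exp (2 * t * (ln (real p) / real p)))"
  proof (intro prod_mono conjI)
    fix p assume p: "p \<in> ?Q"
    show "0 \<le> 1 - real p powr - (1 + t)" using le1[OF p] by simp
    have p2': "2 \<le> real p" using p2[OF p] by simp
    have lnp: "0 \<le> ln (real p)" using p2' by simp
    have "real p powr - (1 + t) = exp (- t * ln (real p)) / real p"
      using p2' by (simp add: powr_def exp_diff exp_minus algebra_simps exp_add divide_simps)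
    moreover have "1 + (- t * ln (real p)) \<le> exp (- t * ln (real p))"
      by (rule exp_ge_add_one_self)
    ultimately have "(1 - t * ln (real p)) / real p \<le> real p powr - (1 + t)"
      using p2' by (simp add: divide_right_mono)
    then have "1 - real p powr - (1 + t) \<le> 1 - 1 / real p + t * (ln (real p) / real p)"
      by (simp add: diff_divide_distrib)
    also have "\<dots> \<le> (1 - 1 / real p) * (1 + 2 * t * (ln (real p) / real p))"
    proof -
      have "1 / 2 * (2 * t * (ln (real p) / real p)) \<le> (1 - 1 / real p) * (2 * t * (ln (real p) / real p))"
        using p2' t lnp by (intro mult_right_mono) (auto simp: field_simps)
      then show ?thesis by (simp add: algebra_simps)
    qed
    also have "\<dots> \<le> (1 - 1 / real p) * exp (2 * t * (ln (real p) / real p))"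
      using p2' exp_ge_add_one_self[of "2 * t * (ln (real p) / real p)"]
      by (intro mult_left_mono) auto
    finally show "1 - real p powr - (1 + t) \<le> (1 - 1 / real p) * exp (2 * t * (ln (real p) / real p))" .
  qed
  also have "\<dots> = free_density ?Q * exp (2 * t * (\<Sum>p\<in>?Q. ln (real p) / real p))"
    by (subst free_density_primes) (auto simp: prod.distrib exp_sum[symmetric] sum_distrib_left)
  also have "\<dots> \<le> free_density ?Q * exp 4"
  proof (intro mult_left_mono)
    have "t * (\<Sum>p\<in>?Q. ln (real p) / real p) \<le> t * (2 * ln (real N))"
      using sum_ln_prime_over_prime[of N] N t by (intro mult_left_mono) auto
    also have "\<dots> = 2" using lnN by (simp add: t_def)
    finally show "exp (2 * t * (\<Sum>p\<in>?Q. ln (real p) / real p)) \<le> exp 4" by simp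
  qed simp
  finally have P: "?P \<le> free_density ?Q * exp 4" .
  have "1 \<le> z * ?P" by (rule 1)
  also have "\<dots> \<le> (1 + ln (real N)) * ?P" using z Ppos by (intro mult_right_mono)
  also have "\<dots> \<le> (1 + ln (real N)) * (free_density ?Q * exp 4)"
    using P lnN by (intro mult_left_mono) auto
  finally show ?thesis by (simp add: mult_ac)
qed

section \<open>The Davenport-Erdos theorem\<close>

text \<open>The event says that \<open>a\<close> is the largest divisor of \<open>\<omega>\<close> that is composed of primes up to \<open>N\<close> (for \<open>a \<le> N\<close>):
\<open>\<omega> = a * \<omega>'\<close> where \<open>\<omega>'\<close> is prime to these primes.\<close>
lemma prob_smooth_part:
  assumes "0 < a"
  shows "measure haar (sieve ((\<lambda>p. a * p) ` primes_upto N) {0} \<inter> {\<omega>. pdvd a 0 \<omega>})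
       = free_density (primes_upto N) / a"
proof -
  have "(\<lambda>c. c div a) ` (\<lambda>p. a * p) ` primes_upto N = primes_upto N"
    using assms by (simp add: image_image)
  moreover have "real a * mult_prob ((\<lambda>p. a * p) ` primes_upto N) a
      = free_density ((\<lambda>c. c div a) ` (\<lambda>p. a * p) ` primes_upto N)"
    using assms prime_gt_0_nat by (intro mult_prob_common_divisor) auto
  ultimately show ?thesis using assms by (simp add: mult_prob_def field_simps)
qed

text \<open>If \<open>k\<close> does not divide \<open>a\<close>, then \<open>lcm a k\<close>, which divides \<open>\<omega>\<close>, is divisible by \<open>a * p\<close> for some prime factor
\<open>p\<close> of \<open>k\<close>.\<close>
lemma smooth_part_dvd:
  assumes "0 < a" "0 < k" "k \<le> N"
    and "\<omega> \<in> sieve ((\<lambda>p. a * p) ` primes_upto N) {0}" "pdvd a 0 \<omega>" "pdvd k 0 \<omega>"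
  shows "k dvd a"
proof (rule ccontr)
  assume "\<not> k dvd a"
  define e where "e = k div gcd k a"
  have e: "k = e * gcd k a" by (simp add: e_def)
  have "e \<noteq> 1" using e \<open>\<not> k dvd a\<close> by (metis gcd_dvd2 mult_1)
  then obtain p where p: "prime p" "p dvd e" using prime_factor_nat by blast
  have "p \<le> k" using p e assms(2) by (metis dvd_imp_le dvd_trans dvd_triv_left)
  moreover have "a * p dvd lcm a k"
    using p(2) unfolding lcm_nat_def e_def by (metis div_mult_swap gcd.commute gcd_dvd1 gcd_dvd2 mult_dvd_mono dvd_refl)
  then have "pdvd (a * p) 0 \<omega>"
    using assms pdvd_mono[of "a * p" "lcm a k" 0 \<omega>] by (simp add: pdvd_lcm lcm_pos_nat)
  ultimately show False using assms p by (auto simp: sieve_def)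
qed

text \<open>A transfer from integers \<open>a \<le> N\<close>, weighted by \<open>1 / a\<close>, to the random \<open>\<omega>\<close>: attach to \<open>a\<close> the event that
the part of \<open>\<omega>\<close> composed of primes up to \<open>N\<close> equals \<open>a\<close>. These events are disjoint, have probability
\<open>V / a\<close> with the same factor \<open>V\<close>, and if \<open>a\<close> is a multiple of \<open>B\<close> but not of \<open>trunc B k\<close>, then so is \<open>\<omega>\<close>.
The factor \<open>V\<close> is of order \<open>1 / ln N\<close> by \<open>mertens_lower\<close>.\<close>
lemma davenport_erdos_tail:
  assumes B: "0 \<notin> B" and N: "2 \<le> N" "k \<le> N"
  shows "(\<Sum>a | a \<in> {1..N} \<and> (\<exists>b\<in>B. b dvd a) \<and> \<not> (\<exists>b\<in>trunc B k. b dvd a). 1 / real a)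
       \<le> exp 4 * (1 + ln (real N)) * (free_density (trunc B k) - free_density B)"
proof -
  let ?T = "{a. a \<in> {1..N} \<and> (\<exists>b\<in>B. b dvd a) \<and> \<not> (\<exists>b\<in>trunc B k. b dvd a)}"
  let ?E = "\<lambda>a. sieve ((\<lambda>p. a * p) ` primes_upto N) {0} \<inter> {\<omega>. pdvd a 0 \<omega>}"
  let ?V = "free_density (primes_upto N)"
  have "(\<Sum>a\<in>?T. ?V / real a) = (\<Sum>a\<in>?T. measure haar (?E a))"
    by (intro sum.cong) (auto simp: prob_smooth_part)
  also have "\<dots> = measure haar (\<Union>a\<in>?T. ?E a)"
  proof (rule haar.finite_measure_finite_Union[symmetric])
    show "disjoint_family_on ?E ?T"
      unfolding disjoint_family_on_def
    proof (intro ballI impI equals0I)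
      fix a c \<omega> assume "a \<in> ?T" "c \<in> ?T" "a \<noteq> c" "\<omega> \<in> ?E a \<inter> ?E c"
      then have "a dvd c" "c dvd a"
        using smooth_part_dvd[of a c N \<omega>] smooth_part_dvd[of c a N \<omega>] by auto
      then show False using \<open>a \<noteq> c\<close> by (simp add: dvd_antisym)
    qed
  qed auto
  also have "\<dots> \<le> measure haar (sieve (trunc B k) {0} - sieve B {0})"
  proof (rule haar.finite_measure_mono)
    show "(\<Union>a\<in>?T. ?E a) \<subseteq> sieve (trunc B k) {0} - sieve B {0}"
    proof
      fix \<omega> assume "\<omega> \<in> (\<Union>a\<in>?T. ?E a)"
      then obtain a where a: "a \<in> ?T" "\<omega> \<in> ?E a" by blast
      obtain b where b: "b \<in> B" "b dvd a" using a by blast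
      have "pdvd b 0 \<omega>" using a b by (intro pdvd_mono[of b a]) auto
      then have "\<omega> \<notin> sieve B {0}" using b by (auto simp: sieve_def)
      moreover have "\<omega> \<in> sieve (trunc B k) {0}"
      proof (rule ccontr)
        assume "\<omega> \<notin> sieve (trunc B k) {0}"
        then obtain c where c: "c \<in> trunc B k" "pdvd c 0 \<omega>" by (auto simp: sieve_def)
        have "0 < c" "c \<le> N" using c B N by (auto simp: trunc_def intro: Nat.gr0I)
        then have "c dvd a" using smooth_part_dvd[of a c N \<omega>] a c by auto
        then show False using a c by auto
      qed
      ultimately show "\<omega> \<in> sieve (trunc B k) {0} - sieve B {0}" by simp
    qed
  qed auto
  also have "\<dots> = free_density (trunc B k) - free_density B"
    unfolding free_prob_def by (rule haar.finite_measure_Diff) (auto simp: sieve_antimono[THEN subsetD, OF trunc_subset subset_refl])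
  finally have main: "?V * (\<Sum>a\<in>?T. 1 / real a) \<le> free_density (trunc B k) - free_density B"
    by (simp add: sum_distrib_left)
  have "(\<Sum>a\<in>?T. 1 / real a) \<le> (exp 4 * (1 + ln (real N)) * ?V) * (\<Sum>a\<in>?T. 1 / real a)"
    using mertens_lower[OF N(1)] sum_nonneg[of ?T "\<lambda>a. 1 / real a"]
      mult_right_mono[of 1 "exp 4 * (1 + ln (real N)) * ?V" "\<Sum>a\<in>?T. 1 / real a"] by simp
  also have "\<dots> = exp 4 * (1 + ln (real N)) * (?V * (\<Sum>a\<in>?T. 1 / real a))"
    by (simp add: mult_ac)
  also have "\<dots> \<le> exp 4 * (1 + ln (real N)) * (free_density (trunc B k) - free_density B)"
    using main N by (intro mult_left_mono) auto
  finally show ?thesis .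
qed

definition log_sum :: "int set \<Rightarrow> nat \<Rightarrow> real" where
  "log_sum A N = (\<Sum>a | a \<in> {1..N} \<and> int a \<in> A. 1 / real a)"

lemma log_density_eq: "log_density A = lim (\<lambda>N. log_sum A N / ln (real N))"
proof -
  have "(\<Sum>a\<in>A \<inter> {1..int N}. 1 / real_of_int a) = log_sum A N" for N
    unfolding log_sum_def
    by (rule sum.reindex_bij_witness[of _ int nat]) auto
  then show ?thesis by (simp add: log_density_def)
qed

lemma log_sum_diff: "log_sum A N = log_sum (A \<inter> C) N + log_sum (A - C) N"
  unfolding log_sum_def
  by (subst sum.union_disjoint[symmetric]) (auto intro!: sum.cong)

lemma harm_div_LIMSEQ:
  assumes a: "0 < a"
  shows "(\<lambda>N. harm (N div a) / ln (real N)) \<longlonglongrightarrow> 1"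
proof (rule tendsto_sandwich)
  show "(\<lambda>N. (ln (real N) - ln (real a)) / ln (real N)) \<longlonglongrightarrow> 1" by real_asymp
  show "(\<lambda>N. (ln (real N) + 1) / ln (real N)) \<longlonglongrightarrow> 1" by real_asymp
  show "\<forall>\<^sub>F N in sequentially. (ln (real N) - ln (real a)) / ln (real N) \<le> harm (N div a) / ln (real N)"
  proof (rule eventually_sequentiallyI[of 2])
    fix N :: nat assume N: "2 \<le> N"
    have "real N \<le> real a * (real (N div a) + 1)"
      by (rule le_mult_Suc_div[OF a])
    then have "ln (real N) \<le> ln (real a * (real (N div a) + 1))"
      using N by (intro ln_mono) auto
    also have "\<dots> = ln (real a) + ln (real (N div a) + 1)"
      using a by (simp add: ln_mult_pos)
    finally show "(ln (real N) - ln (real a)) / ln (real N) \<le> harm (N div a) / ln (real N)"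
      using ln_le_harm[of "N div a"] N by (intro divide_right_mono) auto
  qed
  show "\<forall>\<^sub>F N in sequentially. harm (N div a) / ln (real N) \<le> (ln (real N) + 1) / ln (real N)"
  proof (rule eventually_sequentiallyI[of 2])
    fix N :: nat assume N: "2 \<le> N"
    have "harm (N div a) \<le> (harm N :: real)" by (intro harm_mono) simp
    also have "\<dots> \<le> ln (real N) + 1"
      using decseqD[OF decseq_harm_diff_ln, of 0 "N - 1"] N by (simp add: harm_expand)
    finally show "harm (N div a) / ln (real N) \<le> (ln (real N) + 1) / ln (real N)"
      using N by (intro divide_right_mono) auto
  qed
qed

lemma log_sum_multiples_of:
  assumes a: "0 < a"
  shows "log_sum {m. int a dvd m} N = harm (N div a) / a"
proof -
  have "log_sum {m. int a dvd m} N = (\<Sum>k\<in>{1..N div a}. 1 / real (a * k))"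
    unfolding log_sum_def
    using a by (intro sum.reindex_bij_witness[of _ "\<lambda>k. a * k" "\<lambda>n. n div a"])
      (auto simp: div_le_mono Suc_le_eq div_greater_zero_iff dvd_imp_le less_eq_div_iff_mult_less_eq mult.commute)
  then show ?thesis by (simp add: harm_def sum_distrib_left divide_inverse mult_ac)
qed

text \<open>Logarithmic densities obey the same inclusion-exclusion recursion as \<open>mult_prob\<close>.\<close>
lemma log_density_finite:
  assumes "finite K" "0 \<notin> K" "0 < a"
  shows "(\<lambda>N. log_sum (free_set K \<inter> {m. int a dvd m}) N / ln (real N)) \<longlonglongrightarrow> mult_prob K a"
  using assms
proof (induction K arbitrary: a rule: finite_induct)
  case empty
  have "(\<lambda>N. harm (N div a) / ln (real N) / real a) \<longlonglongrightarrow> 1 / real a"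
    by (intro tendsto_divide harm_div_LIMSEQ tendsto_const) (use empty in auto)
  moreover have "free_set {} = UNIV" by (simp add: free_set_def multiples_def)
  ultimately show ?case using empty by (simp add: log_sum_multiples_of mult_prob_empty mult.commute)
next
  case (insert k K)
  have k: "0 < k" "0 \<notin> K" using insert.prems by auto
  let ?A = "free_set K \<inter> {m. int a dvd m}" and ?C = "free_set K \<inter> {m. int (lcm a k) dvd m}"
  have "log_sum ?A N = log_sum (?A \<inter> {m. int k dvd m}) N + log_sum (?A - {m. int k dvd m}) N" for N
    by (rule log_sum_diff)
  moreover have "?A \<inter> {m. int k dvd m} = ?C"
    by (auto simp flip: lcm_int_int_eq)
  moreover have "?A - {m. int k dvd m} = free_set (insert k K) \<inter> {m. int a dvd m}"
    by (auto simp: free_set_iff)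
  ultimately have eq: "log_sum (free_set (insert k K) \<inter> {m. int a dvd m}) N = log_sum ?A N - log_sum ?C N" for N
    by (metis add_diff_cancel_left')
  have "(\<lambda>N. log_sum ?A N / ln (real N) - log_sum ?C N / ln (real N)) \<longlonglongrightarrow> mult_prob K a - mult_prob K (lcm a k)"
    using insert k by (intro tendsto_diff insert.IH) (auto simp: lcm_pos_nat)
  then show ?case using insert.prems k by (simp add: eq mult_prob_insert diff_divide_distrib)
qed

lemma log_density_free_finite:
  assumes "finite K" "0 \<notin> K"
  shows "(\<lambda>N. log_sum (free_set K) N / ln (real N)) \<longlonglongrightarrow> free_density K"
  using log_density_finite[OF assms, of 1] by (simp add: free_density_mult_prob)

lemma log_density_multiples_finite:
  assumes "finite K" "0 \<notin> K"
  shows "(\<lambda>N. log_sum (multiples K) N / ln (real N)) \<longlonglongrightarrow> 1 - free_density K"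
proof -
  have "log_sum UNIV N = log_sum (multiples K) N + log_sum (free_set K) N" for N
    using log_sum_diff[of UNIV N "multiples K"] by (simp add: free_set_def Compl_eq_Diff_UNIV)
  then have eq: "log_sum (multiples K) N = log_sum UNIV N - log_sum (free_set K) N" for N
    by simp
  have "(\<lambda>N. log_sum UNIV N / ln (real N)) \<longlonglongrightarrow> 1"
    using log_density_free_finite[of "{}"] by (simp add: free_set_def multiples_def)
  from tendsto_diff[OF this log_density_free_finite[OF assms]] show ?thesis
    by (simp add: eq diff_divide_distrib)
qed

lemma multiples_iff: "int a \<in> multiples B \<longleftrightarrow> (\<exists>b\<in>B. b dvd a)"
  by (auto simp: multiples_def image_iff int_dvd_int_iff[symmetric] dvd_def simp del: int_dvd_int_iff)

lemma log_sum_tail: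
  assumes "0 \<notin> B" "2 \<le> N" "k \<le> N"
  shows "log_sum (multiples B - multiples (trunc B k)) N
    \<le> exp 4 * (1 + ln (real N)) * (free_density (trunc B k) - free_density B)"
  using davenport_erdos_tail[OF assms] by (simp add: log_sum_def multiples_iff)

lemma multiples_mono: "K \<subseteq> B \<Longrightarrow> multiples K \<subseteq> multiples B"
  by (auto simp: multiples_def)

text \<open>For the finite set \<open>trunc B k\<close> the density is known, and the rest of the multiples contributes at most a
constant times \<open>free_density (trunc B k) - free_density B\<close>, which is small for large \<open>k\<close>.\<close>
theorem davenport_erdos:
  assumes B: "0 \<notin> B"
  shows "(\<lambda>N. log_sum (multiples B) N / ln (real N)) \<longlonglongrightarrow> 1 - free_density B"
proof (rule LIMSEQ_I)
  fix r :: real assume r: "0 < r"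
  \<comment> \<open>The tail is at most twice exp 4 times \<epsilon>, that is r / 2.\<close>
  define \<epsilon> where "\<epsilon> = r / (4 * exp 4)"
  have \<epsilon>: "0 < \<epsilon>" using r by (simp add: \<epsilon>_def)
  have \<epsilon>r: "\<epsilon> \<le> r / 4" "2 * (exp 4 * \<epsilon>) = r / 2"
    using r one_le_exp_iff[of "4::real"] by (simp_all add: \<epsilon>_def field_simps)
  obtain k where k: "\<bar>free_density (trunc B k) - free_density B\<bar> < \<epsilon>"
    using LIMSEQ_D[OF free_prob_trunc[of B "{0}"] \<epsilon>] by (auto simp: real_norm_def)
  let ?K = "trunc B k"
  have ge: "free_density B \<le> free_density ?K" by (rule free_prob_antimono) (auto simp: trunc_def)
  have K: "finite ?K" "0 \<notin> ?K" using B by (auto simp: trunc_def)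
  obtain N0 where N0: "\<And>N. N \<ge> N0 \<Longrightarrow> \<bar>log_sum (multiples ?K) N / ln (real N) - (1 - free_density ?K)\<bar> < r / 4"
    using LIMSEQ_D[OF log_density_multiples_finite[OF K], of "r / 4"] r by (auto simp: real_norm_def)
  have "\<bar>log_sum (multiples B) N / ln (real N) - (1 - free_density B)\<bar> < r"
    if N: "N \<ge> N0" "N \<ge> k" "N \<ge> 3" for N
  proof -
    have "exp 1 < (3::real)" using e_less_272 by simp
    then have ln1: "1 \<le> ln (real N)" using N by (subst ln_ge_iff) auto
    have split: "log_sum (multiples B) N = log_sum (multiples ?K) N + log_sum (multiples B - multiples ?K) N"
      using log_sum_diff[of "multiples B" N "multiples ?K"] multiples_mono[OF trunc_subset[of B k]]
      by (simp add: Int_absorb1)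
    have "0 \<le> log_sum (multiples B - multiples ?K) N"
      by (auto simp: log_sum_def intro!: sum_nonneg)
    then have lo: "0 \<le> log_sum (multiples B - multiples ?K) N / ln (real N)"
      using ln1 by simp
    have "log_sum (multiples B - multiples ?K) N \<le> exp 4 * (1 + ln (real N)) * (free_density ?K - free_density B)"
      using N by (intro log_sum_tail[OF B]) auto
    also have "\<dots> \<le> exp 4 * (2 * ln (real N)) * \<epsilon>"
      using ln1 k ge by (intro mult_mono) auto
    finally have "log_sum (multiples B - multiples ?K) N / ln (real N) \<le> 2 * (exp 4 * \<epsilon>)"
      using ln1 by (simp add: divide_le_eq mult_ac)
    moreover have "log_sum (multiples B) N / ln (real N)
        = log_sum (multiples ?K) N / ln (real N) + log_sum (multiples B - multiples ?K) N / ln (real N)"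
      by (simp add: split add_divide_distrib)
    moreover have "free_density ?K - free_density B < r / 4"
      using k \<epsilon>r ge by linarith
    ultimately show ?thesis
      using N0[OF N(1)] lo ge \<epsilon>r(2) r by (simp only: abs_less_iff) linarith
  qed
  then show "\<exists>N1. \<forall>N\<ge>N1. norm (log_sum (multiples B) N / ln (real N) - (1 - free_density B)) < r"
    by (intro exI[of _ "max N0 (max k 3)"]) auto
qed

lemma log_density_multiples: "0 \<notin> B \<Longrightarrow> log_density (multiples B) = 1 - free_density B"
  unfolding log_density_eq by (intro limI davenport_erdos)

lemma taut_iff:
  assumes "0 \<notin> B"
  shows "taut B \<longleftrightarrow> (\<forall>b\<in>B. free_density B < free_density (B - {b}))"
  using assms by (auto simp: taut_def log_density_multiples)

section \<open>Patterns of positive probability\<close>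

text \<open>Compare each block of \<open>L\<close> consecutive integers with its last element.\<close>
lemma log_sum_periodic:
  assumes L: "0 < L" and per: "\<And>m. m + int L \<in> A \<longleftrightarrow> m \<in> A"
  shows "card (A \<inter> {0..<int L}) / L * harm J \<le> log_sum A (L * J)"
proof (induction J)
  case (Suc J)
  let ?c = "card (A \<inter> {0..<int L})"
  let ?X = "{a. a \<in> {L * J + 1..L * Suc J} \<and> int a \<in> A}"
  have "bij_betw int {a. a \<in> {M + 1..M + L} \<and> int a \<in> A} (A \<inter> {int (M + 1)..<int (M + 1) + int L})" for M
    by (rule bij_betw_byWitness[where f' = nat]) auto
  from this[of "L * J"]
  have "bij_betw int ?X (A \<inter> {int (L * J + 1)..<int (L * J + 1) + int L})"
    by (simp add: add.commute del: of_nat_Suc)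
  then have "card ?X = card (A \<inter> {int (L * J + 1)..<int (L * J + 1) + int L})"
    by (rule bij_betw_same_card)
  then have card: "card ?X = ?c"
    using card_shift_period[of "int L" A "int (L * J + 1)"] L per by simp
  have "?c / (L * real (Suc J)) = (\<Sum>a\<in>?X. 1 / real (L * Suc J))"
    by (simp only: card sum_constant of_nat_mult) simp
  also have "\<dots> \<le> (\<Sum>a\<in>?X. 1 / real a)"
  proof (intro sum_mono)
    fix a assume "a \<in> ?X"
    then have "1 \<le> a" "a \<le> L * Suc J" by simp_all
    then show "1 / real (L * Suc J) \<le> 1 / real a"
      by (intro frac_le) (simp_all del: of_nat_Suc of_nat_mult mult_Suc_right)
  qed
  finally have "?c / (L * real (Suc J)) \<le> (\<Sum>a\<in>?X. 1 / real a)" .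
  moreover have "?c / L * harm (Suc J) = ?c / L * harm J + ?c / (L * real (Suc J))"
    by (simp add: harm_Suc distrib_left divide_inverse del: of_nat_Suc)
  ultimately have "?c / L * harm (Suc J) \<le> ?c / L * harm J + (\<Sum>a\<in>?X. 1 / real a)"
    by linarith
  also have "\<dots> \<le> log_sum A (L * J) + (\<Sum>a\<in>?X. 1 / real a)"
    using Suc by simp
  also have "\<dots> = log_sum A (L * Suc J)"
    unfolding log_sum_def by (subst sum.union_disjoint[symmetric]) (auto intro!: sum.cong)
  finally show ?case .
qed (simp add: harm_def log_sum_def)

lemma free_prob_finite_periodic:
  assumes K: "\<And>b. b \<in> K \<Longrightarrow> 0 < b \<and> b \<le> n"
  shows "free_prob K U = card ({m. \<forall>u\<in>U. m + u \<in> free_set K} \<inter> {0..<fact n}) / fact n"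
    and "(\<forall>u\<in>U. (m + fact n) + u \<in> free_set K) \<longleftrightarrow> (\<forall>u\<in>U. m + u \<in> free_set K)"
proof -
  have "sieve K U = {\<omega>. residue n \<omega> \<in> {m. \<forall>u\<in>U. m + u \<in> free_set K}}"
    using sieve_iff_free_set[of K n _ U] K by blast
  then show "free_prob K U = card ({m. \<forall>u\<in>U. m + u \<in> free_set K} \<inter> {0..<fact n}) / fact n"
    unfolding free_prob_def by (simp only: prob_residue)
  have "m + fact n + u \<in> free_set K \<longleftrightarrow> m + u \<in> free_set K" for u
    using free_set_period[of K "fact n" "m + u"] K int_dvd_fact by (simp add: algebra_simps)
  then show "(\<forall>u\<in>U. (m + fact n) + u \<in> free_set K) \<longleftrightarrow> (\<forall>u\<in>U. m + u \<in> free_set K)"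
    by simp
qed

lemma log_sum_shift:
  assumes "0 \<le> u" "u \<le> int R"
  shows "log_sum {m. m + u \<in> A} N \<le> (1 + R) * log_sum A (N + R)"
proof -
  let ?X = "{a. a \<in> {1..N} \<and> int a + u \<in> A}"
  have "log_sum {m. m + u \<in> A} N = (\<Sum>a\<in>?X. 1 / real a)" by (simp add: log_sum_def)
  also have "\<dots> \<le> (\<Sum>a\<in>?X. (1 + R) * (1 / real (a + nat u)))"
  proof (intro sum_mono)
    fix a assume "a \<in> ?X"
    then have a: "1 \<le> real a" by simp
    have "real (nat u) \<le> R" using assms by simp
    then have "real a + real (nat u) \<le> (1 + R) * real a"
      using a mult_left_mono[OF a, of R] by (simp add: algebra_simps)
    then show "1 / real a \<le> (1 + R) * (1 / real (a + nat u))"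
      using a by (simp add: divide_simps)
  qed
  also have "\<dots> = (1 + R) * (\<Sum>a\<in>?X. 1 / real (a + nat u))" by (simp add: sum_distrib_left)
  also have "(\<Sum>a\<in>?X. 1 / real (a + nat u)) = (\<Sum>a\<in>(\<lambda>a. a + nat u) ` ?X. 1 / real a)"
    by (subst sum.reindex) auto
  also have "\<dots> \<le> log_sum A (N + R)"
    unfolding log_sum_def using assms by (intro sum_mono2) auto
  finally show ?thesis by (simp add: mult_left_mono)
qed

lemma sum_UN_le:
  fixes f :: "'b \<Rightarrow> real"
  assumes "finite I" "\<And>i. i \<in> I \<Longrightarrow> finite (A i)" "\<And>x. 0 \<le> f x"
  shows "sum f (\<Union>i\<in>I. A i) \<le> (\<Sum>i\<in>I. sum f (A i))"
  using assms(1,2)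
proof (induction I rule: finite_induct)
  case (insert i I)
  have "sum f (\<Union>i\<in>insert i I. A i) \<le> sum f (A i) + sum f (\<Union>i\<in>I. A i)"
    using insert sum.union_inter[of "A i" "\<Union>i\<in>I. A i" f] assms(3)
      sum_nonneg[of "A i \<inter> (\<Union>i\<in>I. A i)" f] by simp
  then show ?case using insert by simp
qed simp

text \<open>The places where \<open>U\<close> fits into the \<open>trunc B k\<close>-free integers have lower logarithmic density at least
\<open>free_prob B U\<close>, uniformly in \<open>k\<close>. If \<open>U\<close> had no translate among the \<open>B\<close>-free integers, each such place
would be a translate of a multiple of \<open>B\<close> that is not a multiple of \<open>trunc B k\<close>; but there are few of those
when \<open>k\<close> is large.\<close>
lemma free_prob_pos_translate_aux:
  assumes B: "0 \<notin> B" and U: "U \<subseteq> {0..int R}" and pos: "0 < free_prob B U"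
  shows "\<exists>m. \<forall>u\<in>U. m + u \<in> free_set B"
proof (rule ccontr)
  assume no: "\<not> ?thesis"
  let ?D = "free_prob B U"
  have finU: "finite U" using U by (rule finite_subset) simp
  have bound: "?D \<le> 2 * card U * (1 + R) * exp 4 * (free_density (trunc B k) - free_density B)" for k
  proof -
    let ?K = "trunc B k" and ?\<delta> = "free_density (trunc B k) - free_density B"
    let ?A = "{m. \<forall>u\<in>U. m + u \<in> free_set ?K}"
    let ?L = "fact k :: nat"
    have K: "0 < b \<and> b \<le> k" if "b \<in> ?K" for b
      using that B by (auto simp: trunc_def intro: Nat.gr0I)
    have \<delta>: "0 \<le> ?\<delta>" using free_prob_antimono[OF trunc_subset order_refl] by simp
    have lower: "?D * harm J \<le> log_sum ?A (?L * J)" for J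
    proof -
      have "?D \<le> free_prob ?K U" by (rule free_prob_antimono[OF trunc_subset order_refl])
      also have "\<dots> = card (?A \<inter> {0..<int ?L}) / real ?L"
        using free_prob_finite_periodic(1)[of ?K k U] K by simp
      finally have "?D * harm J \<le> card (?A \<inter> {0..<int ?L}) / real ?L * harm J"
        by (intro mult_right_mono harm_nonneg)
      also have "\<dots> \<le> log_sum ?A (?L * J)"
        using free_prob_finite_periodic(2)[of ?K k U] K by (intro log_sum_periodic) auto
      finally show ?thesis .
    qed
    let ?T = "multiples B - multiples ?K"
    have upper: "log_sum ?A N \<le> card U * ((1 + R) * log_sum ?T (N + R))" for N
    proof -
      have "log_sum ?A N \<le> (\<Sum>a\<in>(\<Union>u\<in>U. {a. a \<in> {1..N} \<and> int a + u \<in> ?T}). 1 / real a)"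
        unfolding log_sum_def
      proof (intro sum_mono2)
        show "finite (\<Union>u\<in>U. {a \<in> {1..N}. int a + u \<in> ?T})" using finU by auto
        show "{a. a \<in> {1..N} \<and> int a \<in> ?A} \<subseteq> (\<Union>u\<in>U. {a. a \<in> {1..N} \<and> int a + u \<in> ?T})"
        proof
          fix a assume a: "a \<in> {a. a \<in> {1..N} \<and> int a \<in> ?A}"
          obtain u where "u \<in> U" "int a + u \<notin> free_set B" using no by blast
          then show "a \<in> (\<Union>u\<in>U. {a. a \<in> {1..N} \<and> int a + u \<in> ?T})"
            using a by (auto simp: free_set_def)
        qed
      qed auto
      also have "\<dots> \<le> (\<Sum>u\<in>U. \<Sum>a | a \<in> {1..N} \<and> int a + u \<in> ?T. 1 / real a)"
        by (intro sum_UN_le) (use finU in auto)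
      also have "\<dots> = (\<Sum>u\<in>U. log_sum {m. m + u \<in> ?T} N)"
        by (simp add: log_sum_def)
      also have "\<dots> \<le> (\<Sum>u\<in>U. (1 + R) * log_sum ?T (N + R))"
      proof (intro sum_mono)
        fix u assume "u \<in> U"
        then have "0 \<le> u" "u \<le> int R" using U by auto
        then show "log_sum {m. m + u \<in> ?T} N \<le> (1 + R) * log_sum ?T (N + R)"
          using log_sum_shift[of u R ?T N] by simp
      qed
      finally show ?thesis by simp
    qed
    \<comment> \<open>Only the leading order of the logarithm matters, so that L may depend on k.\<close>
    have ev1: "eventually (\<lambda>J. 1 + ln (real (?L * J + R)) \<le> 2 * ln (real J)) sequentially"
      unfolding of_nat_add of_nat_mult by real_asymp
    have "eventually (\<lambda>J. 1 + ln (real (?L * J + R)) \<le> 2 * ln (real J) \<and> J \<ge> k + 2) sequentially"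
      using ev1 eventually_ge_at_top[of "k + 2"] by eventually_elim auto
    then obtain J where J: "1 + ln (real (?L * J + R)) \<le> 2 * ln (real J)" "J \<ge> k + 2"
      by (auto dest: eventually_happens)
    have JL: "J \<le> ?L * J + R"
      using fact_ge_1[of k, where ?'a = nat] mult_le_mono1[of 1 ?L J] by linarith
    have harm: "ln (real J) \<le> harm J" "0 < ln (real J)"
      using order_trans[OF ln_mono[of "real J" "real J + 1"] ln_le_harm[of J]] J(2) by auto
    have "?D * harm J \<le> card U * ((1 + R) * log_sum ?T (?L * J + R))"
      using lower[of J] upper[of "?L * J"] by linarith
    also have "\<dots> \<le> card U * ((1 + R) * (exp 4 * (1 + ln (real (?L * J + R))) * ?\<delta>))"
      using J JL by (intro mult_left_mono log_sum_tail[OF B]) auto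
    also have "\<dots> \<le> card U * ((1 + R) * (exp 4 * (2 * harm J) * ?\<delta>))"
      using J harm \<delta> by (intro mult_left_mono mult_right_mono) auto
    finally have "?D * harm J \<le> (2 * card U * (1 + R) * exp 4 * ?\<delta>) * harm J"
      by (simp add: algebra_simps)
    from mult_right_le_imp_le[OF this] show ?thesis using harm by linarith
  qed
  have "(\<lambda>k. 2 * card U * (1 + R) * exp 4 * (free_density (trunc B k) - free_density B))
     \<longlonglongrightarrow> 2 * card U * (1 + R) * exp 4 * (free_density B - free_density B)"
    by (intro tendsto_intros free_prob_trunc)
  then have "?D \<le> 2 * card U * (1 + R) * exp 4 * (free_density B - free_density B)"
    by (rule LIMSEQ_le_const) (use bound in blast)
  then show False using pos by simp
qed

lemma free_prob_pos_translate:
  assumes B: "0 \<notin> B" and U: "finite U" and pos: "0 < free_prob B U"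
  shows "\<exists>m. \<forall>u\<in>U. m + u \<in> free_set B"
proof -
  \<comment> \<open>Translate U into the nonnegative integers.\<close>
  define s where "s = Max (insert 0 ((\<lambda>u. \<bar>u\<bar>) ` U))"
  have s: "\<bar>u\<bar> \<le> s" if "u \<in> U" for u unfolding s_def using U that by (intro Max_ge) auto
  have "s \<ge> 0" unfolding s_def using U by (intro Max_ge) auto
  then have "(\<lambda>u. u + s) ` U \<subseteq> {0..int (nat (2 * s))}" using s by force
  from free_prob_pos_translate_aux[OF B this] pos free_prob_shift[OF B]
  obtain m where "\<forall>u\<in>U. m + (u + s) \<in> free_set B" by auto
  then show ?thesis by (intro exI[of _ "m + s"]) (simp add: algebra_simps)
qed

section \<open>Taut sets\<close>

text \<open>A taut set already contains a divisor of every number \<open>g\<close> that could be adjoined without changing densities.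
Otherwise \<open>null_multiples_divisor\<close> gives \<open>d\<close> such that the multiples of those \<open>c \<in> B\<close> with \<open>gcd c g = d\<close>
cover almost all multiples of \<open>d\<close>. By Behrend's inequality this remains true when one of these elements,
\<open>b\<close>, is left out. As \<open>d\<close> divides \<open>b\<close>, the element \<open>b\<close> is dispensable in \<open>B\<close>.\<close>
lemma taut_null_multiples:
  assumes B: "0 \<notin> B" "taut B" and g: "0 < g" "mult_prob B g = 0"
  shows "\<exists>b\<in>B. b dvd g"
proof (rule ccontr)
  assume no: "\<not> ?thesis"
  obtain d where d: "d dvd g" "free_density ((\<lambda>c. c div d) ` {c\<in>B. gcd c g = d}) = 0"
    using null_multiples_divisor[OF B(1) g] .
  let ?C = "{c\<in>B. gcd c g = d}"
  have d0: "0 < d" using d g by (auto intro: Nat.gr0I)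
  have "?C \<noteq> {}" using d(2) by (metis free_density_empty image_empty zero_neq_one)
  then obtain b where b: "b \<in> B" "gcd b g = d" by blast
  have b0: "0 < b" using B b by (auto intro: Nat.gr0I)
  have db: "d dvd b" using b by auto
  let ?R = "?C - {b}"
  have rest: "0 \<notin> (\<lambda>c. c div d) ` ?R"
  proof
    assume "0 \<in> (\<lambda>c. c div d) ` ?R"
    then obtain c where "0 = c div d" "c \<in> ?R" by (rule imageE)
    then have c: "c \<in> B" "gcd c g = d" "c div d = 0" by simp_all
    then have "d dvd c" using gcd_dvd1 by blast
    then show False using div_pos_of_dvd[of d c] B c by (metis gr0I less_irrefl)
  qed
  have x: "1 < b div d"
  proof -
    have "b \<noteq> d" using no b d by auto
    moreover have "0 < b div d" using div_pos_of_dvd db b0 by blast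
    ultimately show ?thesis using db by (metis One_nat_def Suc_lessI dvd_div_eq_mult d0 mult_1 less_irrefl)
  qed
  have "(\<lambda>c. c div d) ` ?C = {b div d} \<union> (\<lambda>c. c div d) ` ?R" using b by auto
  then have "free_density {b div d} * free_density ((\<lambda>c. c div d) ` ?R) \<le> 0"
    using behrend[of "{b div d}" "(\<lambda>c. c div d) ` ?R"] d(2) x rest by simp
  moreover have "0 < free_density {b div d}" using x by (subst free_density_singleton) (auto simp: field_simps)
  ultimately have "free_density ((\<lambda>c. c div d) ` ?R) = 0"
    using free_prob_nonneg[of "(\<lambda>c. c div d) ` ?R" "{0}"] by (simp add: mult_le_0_iff)
  then have "mult_prob ?R d = 0"
    using mult_prob_common_divisor[of ?R d] B d0 by auto
  then have "mult_prob (B - {b}) d \<le> 0" using mult_prob_antimono[of ?R "B - {b}" d] by auto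
  then have "mult_prob (B - {b}) b = 0"
    using mult_prob_dvd[OF db b0, of "B - {b}"] mult_prob_nonneg[of "B - {b}" b] by linarith
  then have "free_density B = free_density (B - {b})"
    using mult_prob_insert[of b 1 "B - {b}"] b b0 by (simp add: free_density_mult_prob insert_absorb)
  then show False using B b by (auto simp: taut_iff)
qed

lemma taut_primitive:
  assumes "0 \<notin> B" "taut B" "b \<in> B" "c \<in> B" "c dvd b"
  shows "c = b"
proof (rule ccontr)
  assume "c \<noteq> b"
  have b0: "0 < b" using assms by (auto intro: Nat.gr0I)
  have "sieve (B - {b}) {0} \<subseteq> sieve B {0}"
    using \<open>c \<noteq> b\<close> assms b0 pdvd_mono[of c b 0] by (fastforce simp: sieve_def)
  then have "free_density (B - {b}) \<le> free_density B"
    unfolding free_prob_def by (intro haar.finite_measure_mono) auto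
  then show False using assms by (auto simp: taut_iff)
qed

lemma sieve_null_extension:
  assumes B: "0 \<notin> B" and C: "\<And>c. c \<in> C \<Longrightarrow> 0 < c \<and> mult_prob B c = 0"
    and [measurable]: "E \<in> sets borel"
  shows "measure haar (sieve (B \<union> C) U \<inter> E) = measure haar (sieve B U \<inter> E)"
proof -
  \<comment> \<open>The points that only the new moduli sieve out.\<close>
  let ?N = "\<Union>u\<in>U. \<Union>c\<in>C. sieve B {u} \<inter> {\<omega>. pdvd c u \<omega>}"
  have null: "?N \<in> null_sets haar"
  proof (intro null_sets_UN')
    show "countable U" "countable C" by (auto intro: countable_subset)
    fix u c assume "c \<in> C"
    then have "measure haar (sieve B {u} \<inter> {\<omega>. pdvd c u \<omega>}) = 0"
      using prob_sieve_shift[OF B, of c u "{0}"] C by (simp add: mult_prob_def)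
    then show "sieve B {u} \<inter> {\<omega>. pdvd c u \<omega>} \<in> null_sets haar"
      by (auto simp: null_sets_def haar.emeasure_eq_measure)
  qed
  have "sieve (B \<union> C) U \<inter> E = (sieve B U \<inter> E) - ?N"
    by (auto simp: sieve_def)
  then show ?thesis
    using null by (simp add: measure_Diff_null_set)
qed

text \<open>The set \<open>A\<close> in the proof collects all numbers that can be adjoined without changing densities, and \<open>B'\<close> its
minimal elements.\<close>
lemma exists_taut:
  assumes B: "0 \<notin> B"
  obtains B' where "0 \<notin> B'" "taut B'" "free_set B' \<subseteq> free_set B" "\<And>U. free_prob B' U = free_prob B U"
proof -
  define A where "A = {c. 0 < c \<and> mult_prob B c = 0}"
  define B' where "B' = {c\<in>A. \<forall>d\<in>A. d dvd c \<longrightarrow> d = c}"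
  have BA: "B \<subseteq> A"
  proof
    fix c assume c: "c \<in> B"
    then have "sieve B {0} \<inter> {\<omega>. pdvd c 0 \<omega>} = {}" by (auto simp: sieve_def)
    then show "c \<in> A" using c B by (auto simp: A_def mult_prob_def intro: Nat.gr0I)
  qed
  have min: "\<exists>b\<in>B'. b dvd a" if "a \<in> A" for a
    using that
  proof (induction a rule: less_induct)
    case (less a)
    show ?case
    proof (cases "a \<in> B'")
      case False
      then obtain d where d: "d \<in> A" "d dvd a" "d \<noteq> a" using less.prems by (auto simp: B'_def)
      have "d < a" using d less.prems by (auto simp: A_def dvd_imp_le le_neq_implies_less)
      then show ?thesis using less.IH[of d] d by (meson dvd_trans)
    qed (auto intro: bexI[of _ a])
  qed
  have B'0: "0 \<notin> B'" by (auto simp: B'_def A_def)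
  have sub: "free_set B' \<subseteq> free_set B"
    using min BA by (force simp: free_set_iff subset_eq dest: dvd_trans[OF int_dvd_int_iff[THEN iffD2]])
  have "sieve B' U \<subseteq> sieve B U" for U
  proof
    fix \<omega> assume w: "\<omega> \<in> sieve B' U"
    have "\<not> pdvd b u \<omega>" if ub: "u \<in> U" "b \<in> B" for u b
    proof -
      obtain b' where "b' \<in> B'" "b' dvd b" using min[OF subsetD[OF BA ub(2)]] by blast
      moreover have "0 < b" using ub B by (auto intro: Nat.gr0I)
      ultimately show ?thesis using w ub pdvd_mono[of b' b u \<omega>] by (auto simp: sieve_def)
    qed
    then show "\<omega> \<in> sieve B U" by (auto simp: sieve_def)
  qed
  then have "sieve (B \<union> B') U = sieve B' U" for U
    by (fastforce simp: sieve_def)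
  then have eq: "measure haar (sieve B' U \<inter> E) = measure haar (sieve B U \<inter> E)" if "E \<in> sets borel" for U E
    using sieve_null_extension[OF B, of B' E U] that by (auto simp: B'_def A_def)
  have fp: "free_prob B' U = free_prob B U" for U
    using eq[of UNIV U] by (simp add: free_prob_def)
  have mp: "mult_prob B' a = mult_prob B a" for a
    using eq by (simp add: mult_prob_def)
  have "free_density B' < free_density (B' - {b})" if b: "b \<in> B'" for b
  proof (rule ccontr)
    assume nless: "\<not> ?thesis"
    have b0: "0 < b" using b B'0 by (auto intro: Nat.gr0I)
    have "free_density B' = free_density (B' - {b}) - mult_prob (B' - {b}) b"
      using mult_prob_insert[of b 1 "B' - {b}"] b b0 by (simp add: free_density_mult_prob insert_absorb)
    then have "mult_prob (B' - {b}) b = 0"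
      using nless mult_prob_nonneg[of "B' - {b}" b] by simp
    then obtain d where d: "d dvd b" "free_density ((\<lambda>c. c div d) ` {c\<in>B' - {b}. gcd c b = d}) = 0"
      using null_multiples_divisor[of "B' - {b}" b] B'0 b0 by blast
    let ?C = "{c\<in>B' - {b}. gcd c b = d}"
    have d0: "0 < d" using d b0 by (auto intro: Nat.gr0I)
    have "mult_prob ?C d = 0"
      using mult_prob_common_divisor[of ?C d] d d0 B'0 by auto
    then have "mult_prob B' d = 0"
      using mult_prob_antimono[of ?C B' d] mult_prob_nonneg[of B' d] by auto
    then have "d \<in> A" using mp d0 by (simp add: A_def)
    then have "d = b" using b d by (auto simp: B'_def)
    have "?C \<noteq> {}" using d(2) by (metis free_density_empty image_empty zero_neq_one)
    then obtain c where c: "c \<in> B'" "c \<noteq> b" "gcd c b = b" using \<open>d = b\<close> by blast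
    have "b dvd c" using c(3) gcd_dvd1[of c b] by simp
    then show False using b c by (auto simp: B'_def)
  qed
  then have "taut B'" by (simp add: taut_iff[OF B'0])
  with that B'0 sub fp show ?thesis by blast
qed

section \<open>Residue classes and patterns that meet all of them\<close>

text \<open>The condition on \<open>\<omega>\<close> is the congruence to \<open>c\<close> modulo \<open>b\<close>.\<close>
definition class_prob :: "nat set \<Rightarrow> nat \<Rightarrow> int \<Rightarrow> real" where
  "class_prob B b c = measure haar (sieve B {0} \<inter> {\<omega>. pdvd b (- c) \<omega>})"

lemma class_prob_antimono: "B \<subseteq> C \<Longrightarrow> class_prob C b c \<le> class_prob B b c"
  unfolding class_prob_def by (intro haar.finite_measure_mono Int_mono sieve_antimono) auto

lemma class_prob_finite:
  assumes "\<And>k. k \<in> K \<Longrightarrow> 0 < k \<and> k \<le> n" "0 < b" "b \<le> n"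
  shows "class_prob K b c = card ({m. m \<in> free_set K \<and> int b dvd m - c} \<inter> {0..<fact n}) / fact n"
proof -
  have "sieve K {0} \<inter> {\<omega>. pdvd b (- c) \<omega>} = {\<omega>. residue n \<omega> \<in> {m. m \<in> free_set K \<and> int b dvd m - c}}"
    using sieve_iff_free_set[of K n _ "{0}"] assms pdvd_iff[of b n "- c"] by auto
  then show ?thesis unfolding class_prob_def by (simp only: prob_residue)
qed

text \<open>Add a multiple of \<open>b\<close> by the product of exactly those primes of \<open>L\<close> that do not divide \<open>t\<close>: modulo a
prime of \<open>L\<close>, either \<open>t\<close> or the added term vanishes, but not both.\<close>
lemma coprime_lift:
  fixes t b L :: int
  assumes "coprime t b" "0 < L"
  shows "\<exists>s. coprime (t + b * s) L"
proof -
  let ?Q = "{p\<in>prime_factors L. \<not> p dvd t}"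
  let ?s = "\<Prod>?Q"
  have fin: "finite ?Q" by simp
  have "coprime (t + b * ?s) L"
  proof (rule ccontr)
    assume "\<not> ?thesis"
    then have "\<not> is_unit (gcd (t + b * ?s) L)" by (simp only: is_unit_gcd not_False_eq_True)
    moreover have "gcd (t + b * ?s) L \<noteq> 0" using assms by simp
    ultimately obtain p where p: "prime p" "p dvd gcd (t + b * ?s) L"
      using prime_divisor_exists by blast
    then have pd: "p dvd t + b * ?s" "p dvd L" by auto
    show False
    proof (cases "p dvd t")
      case True
      then have "p dvd b * ?s" using pd by (simp add: dvd_add_right_iff)
      moreover have "\<not> p dvd b" using assms True p(1) by (metis coprime_common_divisor not_prime_unit)
      ultimately have "p dvd ?s" using p(1) by (simp add: prime_dvd_mult_iff)
      then obtain q where "q \<in> ?Q" "p dvd q" using p(1) fin by (auto simp: prime_dvd_prod_iff)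
      then have "p = q" using p(1) by (auto intro: primes_dvd_imp_eq)
      then show False using \<open>q \<in> ?Q\<close> True by simp
    next
      case False
      then have "p \<in> ?Q" using p pd assms by (auto simp: prime_factors_dvd)
      then have "p dvd ?s" using fin by (rule dvd_prodI[rotated])
      then have "p dvd t" using pd by (simp add: dvd_add_left_iff)
      then show False using False by simp
    qed
  qed
  then show ?thesis by blast
qed

lemma unit_between_classes:
  fixes b c c' L :: int
  assumes b: "0 < b" and gcd: "gcd c b = gcd c' b" and L: "0 < L"
  obtains t where "coprime t L" "b dvd t * c - c'"
proof -
  let ?g = "gcd c b"
  have g0: "?g \<noteq> 0" using b by simp
  obtain c1 b1 where c1: "c = c1 * ?g" "b = b1 * ?g" "coprime c1 b1"
    using gcd_coprime_exists[OF g0] by metis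
  obtain c2 b2 where c2: "c' = c2 * ?g" "b = b2 * ?g" "coprime c2 b2"
    using gcd_coprime_exists[of c' b] gcd g0 by metis
  have "b2 * ?g = b1 * ?g" using c1(2) c2(2) by simp
  then have "b2 = b1" using g0 by (simp only: mult_cancel_right) simp
  \<comment> \<open>After division by the gcd both classes consist of units modulo b1.\<close>
  obtain x where x: "[c1 * x = 1] (mod b1)" using cong_solve_coprime_int[OF c1(3)] by blast
  have "coprime (c1 * x) b1" using x by (metis cong_imp_coprime cong_sym coprime_1_left)
  then have "coprime (x * c2) b1" using c2(3) \<open>b2 = b1\<close> by simp
  then obtain s where s: "coprime (x * c2 + b1 * s) L" using coprime_lift L by blast
  have "b1 dvd c1 * x - 1" using x by (simp add: cong_iff_dvd_diff)
  then have "b1 dvd (c1 * x - 1) * c2 + b1 * (s * c1)" by simp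
  then have "b1 dvd (x * c2 + b1 * s) * c1 - c2" by (simp add: algebra_simps)
  then have "b1 * ?g dvd ((x * c2 + b1 * s) * c1 - c2) * ?g" by (rule mult_dvd_mono) simp
  moreover have "((x * c2 + b1 * s) * c1 - c2) * ?g = (x * c2 + b1 * s) * (c1 * ?g) - c2 * ?g"
    by (simp add: algebra_simps)
  ultimately have "b dvd (x * c2 + b1 * s) * c - c'"
    by (simp only: c1(1,2)[symmetric] c2(1)[symmetric])
  with s that show ?thesis by blast
qed

text \<open>Multiplication by a unit modulo \<open>n!\<close> preserves divisibility by every \<open>k \<in> K\<close> and acts transitively on the
classes modulo \<open>b\<close> with the same gcd with \<open>b\<close>.\<close>
lemma class_prob_unit_le:
  assumes K: "finite K" "0 \<notin> K" and b: "0 < b" and gcd: "gcd c (int b) = gcd c' (int b)"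
  shows "class_prob K b c \<le> class_prob K b c'"
proof -
  obtain n where n: "\<And>k. k \<in> insert b K \<Longrightarrow> k \<le> n"
    using K finite_nat_set_iff_bounded_le[of "insert b K"] by auto
  have Kn: "0 < k \<and> k \<le> n" if "k \<in> K" for k using that n K by (auto intro: Nat.gr0I)
  let ?L = "fact n :: int"
  let ?S = "\<lambda>c. {m. m \<in> free_set K \<and> int b dvd m - c} \<inter> {0..<?L}"
  obtain t where t: "coprime t ?L" "int b dvd t * c - c'"
    using unit_between_classes[of "int b" c c' ?L] b gcd by auto
  have "inj_on (\<lambda>m. t * m mod ?L) (?S c)"
  proof (rule inj_onI)
    fix x y assume xy: "x \<in> ?S c" "y \<in> ?S c" "t * x mod ?L = t * y mod ?L"
    then have "[t * x = t * y] (mod ?L)" by (simp add: cong_def)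
    then have "[x = y] (mod ?L)" using t(1) by (simp add: cong_mult_lcancel)
    then show "x = y" using xy by (simp add: cong_def)
  qed
  moreover have "(\<lambda>m. t * m mod ?L) ` ?S c \<subseteq> ?S c'"
  proof (rule image_subsetI)
    fix m assume m: "m \<in> ?S c"
    have "t * m mod ?L \<in> free_set K"
      unfolding free_set_iff
    proof
      fix k assume k: "k \<in> K"
      have kL: "int k dvd ?L" using Kn[OF k] int_dvd_fact by simp
      have "coprime t (int k)" using t(1) kL by (metis coprime_divisors dvd_refl)
      then have "coprime (int k) t" by (simp add: coprime_commute)
      then have "int k dvd t * m \<longleftrightarrow> int k dvd m" by (simp add: coprime_dvd_mult_right_iff)
      then show "\<not> int k dvd t * m mod ?L"
        using m k kL by (simp add: dvd_mod_iff free_set_iff)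
    qed
    moreover have "int b dvd t * m mod ?L - c'"
    proof -
      have "int b dvd ?L" using int_dvd_fact[of b n] b n by simp
      then have "int b dvd t * m mod ?L - t * m"
        by (metis dvd_trans dvd_minus_mod dvd_diff_commute)
      moreover have "int b dvd t * (m - c) + (t * c - c')" using m t(2) by (intro dvd_add dvd_mult) auto
      ultimately have "int b dvd (t * m mod ?L - t * m) + (t * (m - c) + (t * c - c'))" by (rule dvd_add)
      then show ?thesis by (simp add: algebra_simps)
    qed
    ultimately show "t * m mod ?L \<in> ?S c'" by simp
  qed
  ultimately have "card (?S c) \<le> card (?S c')" by (intro card_inj_on_le) auto
  then show ?thesis
    using class_prob_finite[of K n b c] class_prob_finite[of K n b c'] Kn n b
    by (simp add: divide_right_mono)
qed

text \<open>Let \<open>g = gcd c b\<close>. The event \<open>gcd \<omega> b = g\<close> says that \<open>g\<close> divides \<open>\<omega>\<close> and \<open>\<omega> / g\<close> is prime to finitely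
many primes; by Behrend's inequality, imposing the latter costs at most a fixed positive factor. The
event is a union of classes that all have the probability of the class of \<open>c\<close> by
\<open>class_prob_unit_le\<close>. The bound is uniform over the finite sets \<open>trunc B k\<close>, hence survives the limit.\<close>
lemma class_prob_lower:
  assumes B: "0 \<notin> B" and b: "0 < b" and pos: "0 < mult_prob B b"
  shows "0 < class_prob B b c"
proof -
  define g where "g = nat (gcd c (int b))"
  have g: "int g = gcd c (int b)" by (simp add: g_def)
  have g0: "0 < g" and gb: "g dvd b"
    using b g by (auto simp: g_def simp flip: int_dvd_int_iff)
  define P where "P = {p. prime p \<and> p dvd b div g}"
  have bg0: "0 < b div g" using div_pos_of_dvd gb b by blast
  have P: "finite P" "\<And>p. p \<in> P \<Longrightarrow> prime p"
    using bg0 by (auto simp: P_def intro: finite_subset[OF _ finite_divisors_nat])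
  have fP: "0 < free_density P"
  proof (subst free_density_primes[OF P], assumption, intro prod_pos)
    show "0 < 1 - 1 / real p" if "p \<in> P" for p
      using prime_gt_1_nat[OF P(2)[OF that]] by (simp add: field_simps)
  qed
  let ?\<kappa> = "mult_prob B b * free_density P"
  have \<kappa>: "0 < ?\<kappa>" using pos fP by simp
  have bound: "?\<kappa> / b \<le> class_prob (trunc B k) b c" for k
  proof -
    let ?K = "trunc B k" and ?gP = "(\<lambda>p. g * p) ` P"
    have K: "finite ?K" "0 \<notin> ?K" using B by (auto simp: trunc_def)
    have "0 \<notin> P" using P(2) not_prime_0 by blast
    then have gP: "0 \<notin> ?gP" using g0 by auto
    have img: "(\<lambda>k. k div gcd k g) ` (?K \<union> ?gP) = (\<lambda>k. k div gcd k g) ` ?K \<union> P"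
    proof -
      have "(\<lambda>k. k div gcd k g) ` ?gP = P"
        using g0 by (simp add: image_image gcd_mult_distrib_nat[symmetric] gcd_proj2_if_dvd_nat)
      then show ?thesis by (simp add: image_Un)
    qed
    have "mult_prob B b \<le> mult_prob ?K g"
      using mult_prob_dvd[OF gb b, of B] mult_prob_antimono[OF trunc_subset[of B k], of g] by linarith
    then have "?\<kappa> \<le> mult_prob ?K g * free_density P" using fP by simp
    also have "\<dots> \<le> mult_prob (?K \<union> ?gP) g"
    proof -
      have "0 \<notin> (\<lambda>k. k div gcd k g) ` ?K"
      proof
        assume "0 \<in> (\<lambda>k. k div gcd k g) ` ?K"
        then obtain k where "k \<in> ?K" "k div gcd k g = 0" by auto
        then show False using div_pos_of_dvd[of "gcd k g" k] K by (metis gcd_dvd1 gr0I less_irrefl)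
      qed
      moreover have "0 \<notin> P" using P(2) not_prime_0 by blast
      ultimately have "free_density ((\<lambda>k. k div gcd k g) ` ?K) * free_density P
          \<le> free_density ((\<lambda>k. k div gcd k g) ` ?K \<union> P)" by (rule behrend)
      then have "(real g * mult_prob ?K g) * free_density P \<le> real g * mult_prob (?K \<union> ?gP) g"
        using mult_prob_scale[of ?K g 1] mult_prob_scale[of "?K \<union> ?gP" g 1] K gP g0
        by (simp add: free_density_mult_prob img)
      then show ?thesis using g0 by (simp add: mult.assoc)
    qed
    also have "\<dots> \<le> measure haar (\<Union>d\<in>{d\<in>{0..<int b}. gcd d (int b) = int g}. sieve ?K {0} \<inter> {\<omega>. pdvd b (- d) \<omega>})"
      unfolding mult_prob_def
    proof (rule haar.finite_measure_mono, rule subsetI)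
      fix \<omega> assume w: "\<omega> \<in> sieve (?K \<union> ?gP) {0} \<inter> {\<omega>. pdvd g 0 \<omega>}"
      let ?d = "residue b \<omega> mod int b"
      have "gcd ?d (int b) = int g"
      proof (rule ccontr)
        assume ne: "gcd ?d (int b) \<noteq> int g"
        let ?h = "gcd (residue b \<omega>) (int b)"
        have h: "?h = gcd ?d (int b)" by (simp add: gcd.commute gcd_red_int[symmetric])
        have "int g dvd residue b \<omega>"
          using w pdvd_iff[of g b 0 \<omega>] g0 dvd_imp_le[OF gb b] by simp
        then have "int g dvd ?h" using gb by simp
        then obtain e where e: "?h = int g * e" by (rule dvdE)
        have "?h > 0" using b by simp
        then have "e > 0" using e g0 by (simp add: zero_less_mult_iff)
        moreover have "e \<noteq> 1" using e ne h by auto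
        ultimately have "nat e \<noteq> 1" by simp
        then obtain p where p: "prime p" "p dvd nat e" using prime_factor_nat by blast
        have "int p dvd int (nat e)" using p(2) by (simp only: int_dvd_int_iff)
        then have pe: "int p dvd e" using \<open>e > 0\<close> by simp
        then have gp: "int (g * p) dvd ?h" using e by simp
        then have "int (g * p) dvd int b" "int (g * p) dvd residue b \<omega>" by (meson dvd_trans gcd_dvd1 gcd_dvd2)+
        then have gpb: "g * p dvd b" by (simp only: int_dvd_int_iff)
        then have "p dvd b div g" using gb g0 by (simp add: dvd_div_iff_mult mult.commute)
        then have "p \<in> P" using p by (simp add: P_def)
        moreover have "pdvd (g * p) 0 \<omega>"
          using pdvd_iff[of "g * p" b 0 \<omega>] \<open>int (g * p) dvd residue b \<omega>\<close> gpb b g0 p(1)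
          by (simp add: dvd_imp_le prime_gt_0_nat)
        ultimately show False using w by (auto simp: sieve_def)
      qed
      moreover have "pdvd b (- ?d) \<omega>" by (simp add: pdvd_def)
      moreover have "\<omega> \<in> sieve ?K {0}" using w by (auto simp: sieve_def)
      ultimately show "\<omega> \<in> (\<Union>d\<in>{d\<in>{0..<int b}. gcd d (int b) = int g}. sieve ?K {0} \<inter> {\<omega>. pdvd b (- d) \<omega>})"
        using b by (intro UN_I[of ?d]) auto
    qed (auto intro!: sets.finite_UN)
    also have "\<dots> \<le> (\<Sum>d\<in>{d\<in>{0..<int b}. gcd d (int b) = int g}. class_prob ?K b d)"
      unfolding class_prob_def
      by (intro haar.finite_measure_subadditive_finite) (auto intro: finite_subset[of _ "{0..<int b}"])
    also have "\<dots> \<le> (\<Sum>d\<in>{d\<in>{0..<int b}. gcd d (int b) = int g}. class_prob ?K b c)"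
      using K b g by (intro sum_mono class_prob_unit_le) auto
    also have "\<dots> \<le> (\<Sum>d\<in>{0..<int b}. class_prob ?K b c)"
      by (intro sum_mono2) (auto simp: class_prob_def)
    also have "\<dots> = b * class_prob ?K b c" by simp
    finally show ?thesis using b by (simp add: field_simps)
  qed
  have "(\<lambda>k. class_prob (trunc B k) b c) \<longlonglongrightarrow> class_prob B b c"
    unfolding class_prob_def by (rule sieve_trunc_LIMSEQ) simp
  then have "?\<kappa> / b \<le> class_prob B b c"
    by (rule LIMSEQ_le_const) (use bound in blast)
  moreover have "0 < ?\<kappa> / b" using \<kappa> b by simp
  ultimately show ?thesis by linarith
qed

lemma free_prob_trunc_diff:
  assumes B: "0 \<notin> B" and V: "finite V"
  shows "free_prob (trunc B k) V - free_prob B V \<le> card V * (free_density (trunc B k) - free_density B)"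
proof -
  let ?K = "trunc B k"
  have sub: "sieve B U \<subseteq> sieve ?K U" for U by (rule sieve_antimono[OF trunc_subset order_refl])
  have diff: "measure haar (sieve ?K U - sieve B U) = free_prob ?K U - free_prob B U" for U
    unfolding free_prob_def using sub by (intro haar.finite_measure_Diff) auto
  have "free_prob ?K V - free_prob B V = measure haar (sieve ?K V - sieve B V)" by (simp add: diff)
  also have "\<dots> \<le> measure haar (\<Union>v\<in>V. sieve ?K {v} - sieve B {v})"
    using V by (intro haar.finite_measure_mono) (auto simp: sieve_def intro!: sets.finite_UN)
  also have "\<dots> \<le> (\<Sum>v\<in>V. measure haar (sieve ?K {v} - sieve B {v}))"
    using V by (intro haar.finite_measure_subadditive_finite) auto
  also have "\<dots> = (\<Sum>v\<in>V. free_density ?K - free_density B)"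
  proof (intro sum.cong refl)
    fix v
    have "0 \<notin> ?K" using B by (auto simp: trunc_def)
    then have "free_prob ?K {v} = free_density ?K" "free_prob B {v} = free_density B"
      using free_prob_shift[of _ v "{0}"] B by auto
    then show "measure haar (sieve ?K {v} - sieve B {v}) = free_density ?K - free_density B"
      by (simp add: diff)
  qed
  finally show ?thesis by simp
qed

text \<open>For the finite set \<open>trunc B k\<close>, average over all \<open>n\<close> of the class of \<open>c\<close> in one period: the mean number of
occurrences of \<open>insert n U\<close> is at least the proportion \<open>q\<close> of the number of occurrences of \<open>U\<close>, so some \<open>n\<close>
does as well as the mean. Passing from \<open>trunc B k\<close> to \<open>B\<close> loses little if \<open>k\<close> is large, uniformly in \<open>n\<close>; this
matters because the choice of \<open>n\<close> depends on \<open>k\<close>.\<close>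
lemma extend_pattern:
  assumes B: "0 \<notin> B" and b: "0 < b" and U: "finite U" and pos: "0 < free_prob B U"
    and q: "0 < q" "\<And>c. q \<le> class_prob B b c"
  shows "\<exists>n. int b dvd n - c \<and> 0 < free_prob B (insert n U)"
proof -
  let ?D = "free_prob B U"
  \<comment> \<open>The loss of at most card U + 1 times \<epsilon> must stay below q times the probability of U.\<close>
  define \<epsilon> where "\<epsilon> = q * ?D / (card U + 2)"
  have \<epsilon>: "0 < \<epsilon>" using q pos by (simp add: \<epsilon>_def)
  obtain k0 where k0: "\<And>k. k \<ge> k0 \<Longrightarrow> \<bar>free_density (trunc B k) - free_density B\<bar> < \<epsilon>"
    using LIMSEQ_D[OF free_prob_trunc[of B "{0}"] \<epsilon>] by (auto simp: real_norm_def)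
  define k where "k = max k0 b"
  let ?K = "trunc B k" and ?L = "fact k :: nat"
  have \<delta>: "free_density ?K - free_density B < \<epsilon>" using k0[of k] by (simp add: k_def)
  have K: "0 < j \<and> j \<le> k" if "j \<in> ?K" for j
    using that B by (auto simp: trunc_def intro: Nat.gr0I)
  let ?A = "{m. \<forall>u\<in>U. m + u \<in> free_set ?K} \<inter> {0..<int ?L}"
  let ?S = "{n\<in>{0..<int ?L}. int b dvd n - c}"
  have bL: "int b dvd int ?L" using int_dvd_fact[of b k] b by (simp add: k_def)
  have inner: "q * ?L \<le> card {n\<in>?S. m + n \<in> free_set ?K}" for m
  proof -
    let ?T = "{j. j \<in> free_set ?K \<and> int b dvd j - (m + c)}"
    have per: "j + int ?L \<in> ?T \<longleftrightarrow> j \<in> ?T" for j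
    proof -
      have "int b dvd j + int ?L - (m + c) \<longleftrightarrow> int b dvd j - (m + c)"
        using bL dvd_add_left_iff[of "int b" "int ?L" "j - (m + c)"] by (simp add: algebra_simps)
      moreover have "j + int ?L \<in> free_set ?K \<longleftrightarrow> j \<in> free_set ?K"
        using K int_dvd_fact by (intro free_set_period) simp
      ultimately show ?thesis by simp
    qed
    have "bij_betw (\<lambda>n. m + n) {n\<in>?S. m + n \<in> free_set ?K} (?T \<inter> {m..<m + int ?L})"
      by (rule bij_betw_byWitness[where f' = "\<lambda>j. j - m"]) (auto simp: algebra_simps)
    then have "card {n\<in>?S. m + n \<in> free_set ?K} = card (?T \<inter> {m..<m + int ?L})"
      by (rule bij_betw_same_card)
    also have "\<dots> = card (?T \<inter> {0..<int ?L})" using per by (intro card_shift_period) auto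
    finally have "real (card {n\<in>?S. m + n \<in> free_set ?K}) = class_prob ?K b (m + c) * ?L"
      using class_prob_finite[of ?K k b "m + c"] K b by (simp add: k_def)
    moreover have "q \<le> class_prob ?K b (m + c)"
      using q(2)[of "m + c"] class_prob_antimono[OF trunc_subset[of B k], of b "m + c"] by linarith
    ultimately show ?thesis by (simp add: mult_right_mono)
  qed
  have fp: "free_prob ?K (insert n U) * ?L = card {m\<in>?A. m + n \<in> free_set ?K}" for n
  proof -
    have "{m. \<forall>u\<in>insert n U. m + u \<in> free_set ?K} \<inter> {0..<int ?L} = {m\<in>?A. m + n \<in> free_set ?K}" by auto
    then show ?thesis using free_prob_finite_periodic(1)[of ?K k "insert n U"] K by simp
  qed
  have DA: "?D * ?L \<le> card ?A"
  proof -
    have "?D \<le> free_prob ?K U" by (rule free_prob_antimono[OF trunc_subset order_refl])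
    then show ?thesis using free_prob_finite_periodic(1)[of ?K k U] K by (simp add: field_simps)
  qed
  have "\<exists>n\<in>?S. q * ?D \<le> free_prob ?K (insert n U)"
  proof (rule ccontr)
    assume "\<not> ?thesis"
    then have less: "free_prob ?K (insert n U) < q * ?D" if "n \<in> ?S" for n using that by force
    have "card ?A * (q * ?L) \<le> (\<Sum>m\<in>?A. real (card {n\<in>?S. m + n \<in> free_set ?K}))"
      using sum_mono[of ?A "\<lambda>_. q * ?L" "\<lambda>m. real (card {n\<in>?S. m + n \<in> free_set ?K})"] inner by simp
    also have "\<dots> = (\<Sum>n\<in>?S. real (card {m\<in>?A. m + n \<in> free_set ?K}))"
    proof -
      have "(\<Sum>m\<in>?A. card {n\<in>?S. m + n \<in> free_set ?K}) = (\<Sum>n\<in>?S. card {m\<in>?A. m + n \<in> free_set ?K})"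
        by (rule sum_multicount_gen) (auto intro: finite_subset[of _ "{0..<int ?L}"])
      then show ?thesis unfolding of_nat_sum[symmetric] by (rule arg_cong)
    qed
    also have "\<dots> = ?L * (\<Sum>n\<in>?S. free_prob ?K (insert n U))"
      by (simp only: fp[symmetric] sum_distrib_left mult.commute)
    finally have 1: "card ?A * q \<le> (\<Sum>n\<in>?S. free_prob ?K (insert n U))"
      by (simp add: field_simps)
    have "?D * ?L * q \<le> card ?A * q" using DA q by (intro mult_right_mono) auto
    then have 2: "?D * ?L * q \<le> (\<Sum>n\<in>?S. free_prob ?K (insert n U))" using 1 by linarith
    have "?S \<noteq> {}"
    proof
      assume S: "?S = {}"
      have "?D * ?L * q \<le> 0" using 2 unfolding S by simp
      moreover have "0 < ?D * ?L * q" using pos q by simp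
      ultimately show False by linarith
    qed
    then have "(\<Sum>n\<in>?S. free_prob ?K (insert n U)) < (\<Sum>n\<in>?S. q * ?D)"
      using less by (intro sum_strict_mono) (auto intro: finite_subset[of _ "{0..<int ?L}"])
    also have "\<dots> = card ?S * (q * ?D)" by simp
    also have "\<dots> \<le> ?L * (q * ?D)"
    proof (intro mult_right_mono)
      have "card ?S \<le> card {0..<int ?L}" by (intro card_mono) auto
      then have "card ?S \<le> ?L" by (simp only: card_atLeastLessThan_int diff_zero nat_int)
      then show "real (card ?S) \<le> real ?L" by (rule of_nat_mono)
    qed (use pos q in simp)
    finally show False using 2 by (simp add: mult_ac)
  qed
  then obtain n where n: "n \<in> ?S" "q * ?D \<le> free_prob ?K (insert n U)" by blast
  have "free_prob ?K (insert n U) - free_prob B (insert n U)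
     \<le> card (insert n U) * (free_density ?K - free_density B)"
    using free_prob_trunc_diff[OF B, of "insert n U"] U by simp
  also have "\<dots> \<le> (card U + 1) * \<epsilon>"
    using \<delta> card_insert_le_m1[of "card U + 1" U n] U free_prob_antimono[OF trunc_subset order_refl, of B "{0}" k]
    by (intro mult_mono) (auto simp: card_insert_if)
  also have "\<dots> < (card U + 2) * \<epsilon>" using \<epsilon> by simp
  also have "\<dots> = q * ?D" by (simp add: \<epsilon>_def)
  finally have "0 < free_prob B (insert n U)" using n(2) by linarith
  then show ?thesis using n(1) by auto
qed

lemma pattern_hitting_all_classes:
  assumes B: "0 \<notin> B" and b: "0 < b" and pos: "0 < mult_prob B b"
  shows "\<exists>U. finite U \<and> 0 < free_prob B U \<and> (\<forall>c. \<exists>n\<in>U. int b dvd n - c)"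
proof -
  define q where "q = Min (class_prob B b ` {0..<int b})"
  have ne: "{0..<int b} \<noteq> {}" using b by simp
  have q0: "0 < q" unfolding q_def using class_prob_lower[OF B b pos] ne by (subst Min_gr_iff) auto
  have mod: "class_prob B b (c mod int b) = class_prob B b c" for c
  proof -
    have "pdvd b (- (c mod int b)) \<omega> \<longleftrightarrow> pdvd b (- c) \<omega>" for \<omega>
    proof -
      have "int b dvd c - c mod int b" by simp
      then have "int b dvd (residue b \<omega> - c) + (c - c mod int b) \<longleftrightarrow> int b dvd residue b \<omega> - c"
        by (rule dvd_add_left_iff)
      then show ?thesis by (simp add: pdvd_def)
    qed
    then show ?thesis by (simp add: class_prob_def)
  qed
  have q: "q \<le> class_prob B b c" for c
    unfolding mod[of c, symmetric] q_def using b by (intro Min_le) auto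
  have "\<exists>U. finite U \<and> 0 < free_prob B U \<and> (\<forall>c\<in>{0..<int j}. \<exists>n\<in>U. int b dvd n - c)" for j
  proof (induction j)
    case 0
    have "0 < free_prob B {}"
      by (simp add: free_prob_def sieve_def haar.prob_space[unfolded space_haar])
    then show ?case by (intro exI[of _ "{}"]) simp
  next
    case (Suc j)
    then obtain U where U: "finite U" "0 < free_prob B U" "\<forall>c\<in>{0..<int j}. \<exists>n\<in>U. int b dvd n - c"
      by blast
    obtain n where n: "int b dvd n - int j" "0 < free_prob B (insert n U)"
      using extend_pattern[OF B b U(1,2) q0 q, of "int j"] by blast
    have "\<exists>n'\<in>insert n U. int b dvd n' - c" if "c \<in> {0..<int (Suc j)}" for c
      using U(3) n(1) that by (cases "c = int j") auto
    then show ?case using U n by (intro exI[of _ "insert n U"]) auto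
  qed
  then obtain U where U: "finite U" "0 < free_prob B U" "\<forall>c\<in>{0..<int b}. \<exists>n\<in>U. int b dvd n - c"
    by blast
  have "\<exists>n\<in>U. int b dvd n - c" for c
  proof -
    obtain n where n: "n \<in> U" "int b dvd n - c mod int b" using U(3) b
      by (meson atLeastLessThan_iff of_nat_0_less_iff pos_mod_bound pos_mod_sign)
    have "int b dvd (n - c mod int b) - (c - c mod int b)"
      by (rule dvd_diff[OF n(2) dvd_minus_mod])
    also have "(n - c mod int b) - (c - c mod int b) = n - c" by simp
    finally show ?thesis using n(1) by blast
  qed
  then show ?thesis using U by blast
qed

lemma free_prob_hitting_zero:
  assumes "b \<in> B" "\<And>c. \<exists>n\<in>U. int b dvd n - c"
  shows "free_prob B U = 0"
proof -
  have "\<omega> \<notin> sieve B U" for \<omega>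
    using assms(1) assms(2)[of "- residue b \<omega>"] by (auto simp: sieve_def pdvd_def add.commute)
  then have "sieve B U = {}" by blast
  then show ?thesis by (simp add: free_prob_def)
qed

text \<open>If no element of \<open>B\<close> divides \<open>b\<close>, the multiples of \<open>b\<close> are \<open>B\<close>-free with positive probability, and a pattern
that meets all classes modulo \<open>b\<close> separates \<open>B\<close> from \<open>C\<close>.\<close>
lemma divisor_of_zero_patterns:
  assumes B: "0 \<notin> B" "taut B" and C: "0 \<notin> C" "b \<in> C"
    and zero: "\<And>U. finite U \<Longrightarrow> free_prob C U = 0 \<Longrightarrow> free_prob B U = 0"
  shows "\<exists>a\<in>B. a dvd b"
proof -
  have b: "0 < b" using C by (auto intro: Nat.gr0I)
  show ?thesis
  proof (cases "mult_prob B b = 0")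
    case True
    then show ?thesis by (rule taut_null_multiples[OF B b])
  next
    case False
    then have "0 < mult_prob B b" using mult_prob_nonneg[of B b] by linarith
    from pattern_hitting_all_classes[OF B(1) b this]
    obtain U where U: "finite U" "0 < free_prob B U" "\<And>c. \<exists>n\<in>U. int b dvd n - c" by blast
    have "free_prob C U = 0" using free_prob_hitting_zero[OF C(2)] U(3) by blast
    then show ?thesis using zero U by fastforce
  qed
qed

lemma taut_unique:
  assumes "0 \<notin> B" "taut B" "0 \<notin> C" "taut C"
    and zero: "\<And>U. finite U \<Longrightarrow> free_prob B U = 0 \<longleftrightarrow> free_prob C U = 0"
  shows "B \<subseteq> C"
proof
  fix b assume b: "b \<in> B"
  obtain c where c: "c \<in> C" "c dvd b" using divisor_of_zero_patterns[of C B b] assms b by blast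
  obtain a where a: "a \<in> B" "a dvd c" using divisor_of_zero_patterns[of B C c] assms c by blast
  have "a = b" using taut_primitive[of B b a] assms a b c by (meson dvd_trans)
  then show "b \<in> C" using a c by (metis dvd_antisym)
qed

section \<open>Invariant measures on hereditary closures\<close>

definition cylinder :: "int set \<Rightarrow> config set" where
  "cylinder U = {y. \<forall>u\<in>U. y u}"

text \<open>The basic neighbourhoods of the product topology fix finitely many coordinates.\<close>
lemma open_config_nhd:
  fixes S :: "config set"
  assumes "open S" "y \<in> S"
  shows "\<exists>W. finite W \<and> (\<forall>z. (\<forall>w\<in>W. z w = y w) \<longrightarrow> z \<in> S)"
proof -
  have "openin (product_topology (\<lambda>i. euclidean) UNIV) S"
    using assms(1) by (simp add: open_fun_def)
  then obtain V where V: "finite {i \<in> UNIV. V i \<noteq> topspace (euclidean :: bool topology)}"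
      "y \<in> Pi\<^sub>E UNIV V" "Pi\<^sub>E UNIV V \<subseteq> S"
    using assms(2) unfolding openin_product_topology_alt by blast
  have "z \<in> S" if "\<forall>w\<in>{i. V i \<noteq> UNIV}. z w = y w" for z
  proof -
    have "z i \<in> V i" for i using that V(2) by (cases "V i = UNIV") (auto simp: PiE_iff)
    then show ?thesis using V(3) by (auto simp: PiE_iff)
  qed
  then show ?thesis using V(1) by (intro exI[of _ "{i. V i \<noteq> UNIV}"]) auto
qed

lemma open_coordinate: "open {y::config. P (y i)}"
proof -
  have "open ((\<lambda>y::config. y i) -` Collect P)"
    by (intro open_vimage continuous_on_product_coordinates discrete_topology_class.open_discrete)
  then show ?thesis by (simp add: vimage_def)
qed

lemma open_cylinder: "finite U \<Longrightarrow> open (cylinder U)"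
proof -
  assume "finite U"
  then have "open (\<Inter>u\<in>U. {y::config. y u})" by (intro open_INT) (auto intro: open_coordinate)
  moreover have "(\<Inter>u\<in>U. {y::config. y u}) = cylinder U" by (auto simp: cylinder_def)
  ultimately show ?thesis by simp
qed

lemma cylinder_borel [measurable]: "finite U \<Longrightarrow> cylinder U \<in> sets borel"
  by (simp add: open_cylinder)

text \<open>An open set is a union of sets that prescribe finitely many coordinates, there are countably many of
these, and each is a Boolean combination of cylinders.\<close>
lemma sets_borel_config: "sets (borel :: config measure) = sigma_sets UNIV (cylinder ` {U. finite U})"
proof
  show "sigma_sets UNIV (cylinder ` {U. finite U}) \<subseteq> sets (borel :: config measure)"
    using sets.sigma_sets_subset[of "cylinder ` {U. finite U}" "borel :: config measure"]
    by (simp add: image_subset_iff open_cylinder)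
  interpret sa: sigma_algebra UNIV "sigma_sets UNIV (cylinder ` {U. finite U})"
    by (rule sigma_algebra_sigma_sets) auto
  define box where "box U V = {z::config. (\<forall>u\<in>U. z u) \<and> (\<forall>v\<in>V. \<not> z v)}" for U V
  have cyl: "cylinder U \<in> sigma_sets UNIV (cylinder ` {U. finite U})" if "finite U" for U
    using that by (intro sigma_sets.Basic) auto
  have box: "box U V \<in> sigma_sets UNIV (cylinder ` {U. finite U})" if "finite U" "finite V" for U V
  proof -
    have "box U V = cylinder U - (\<Union>v\<in>V. cylinder {v})" by (auto simp: box_def cylinder_def)
    then show ?thesis using that by (auto intro!: sa.Diff sa.finite_UN cyl)
  qed
  show "sets (borel :: config measure) \<subseteq> sigma_sets UNIV (cylinder ` {U. finite U})"
    unfolding borel_def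
  proof (simp, intro sa.sigma_sets_subset subsetI)
    fix S :: "config set" assume "S \<in> Collect open"
    then have S: "open S" by simp
    let ?I = "{(U, V). finite U \<and> finite V \<and> box U V \<subseteq> S}"
    have "?I \<subseteq> Collect finite \<times> Collect finite" by auto
    then have cI: "countable ?I"
      by (rule countable_subset) (intro countable_SIGMA countable_Collect_finite)
    have "S = (\<Union>(U, V)\<in>?I. box U V)"
    proof (intro equalityI subsetI)
      fix y assume "y \<in> S"
      then obtain W where W: "finite W" "\<And>z. (\<forall>w\<in>W. z w = y w) \<Longrightarrow> z \<in> S"
        using open_config_nhd[OF S] by metis
      let ?U = "{w\<in>W. y w}" and ?V = "{w\<in>W. \<not> y w}"
      have "(?U, ?V) \<in> ?I" using W by (auto simp: box_def)
      moreover have "y \<in> box ?U ?V" by (auto simp: box_def)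
      ultimately show "y \<in> (\<Union>(U, V)\<in>?I. box U V)" by blast
    qed auto
    also have "\<dots> \<in> sigma_sets UNIV (cylinder ` {U. finite U})"
      using cI box by (intro sa.countable_UN') auto
    finally show "S \<in> sigma_sets UNIV (cylinder ` {U. finite U})" .
  qed
qed

lemma config_measure_eqI:
  fixes \<mu> \<nu> :: "config measure"
  assumes "finite_measure \<mu>" "sets \<mu> = sets borel" "sets \<nu> = sets borel"
    and eq: "\<And>U. finite U \<Longrightarrow> emeasure \<mu> (cylinder U) = emeasure \<nu> (cylinder U)"
  shows "\<mu> = \<nu>"
proof (rule measure_eqI_generator_eq[where \<Omega> = UNIV and E = "cylinder ` {U. finite U}" and A = "\<lambda>_. UNIV"])
  have "cylinder U \<inter> cylinder V = cylinder (U \<union> V)" for U V by (auto simp: cylinder_def)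
  then show "Int_stable (cylinder ` {U. finite U})"
    by (auto simp: Int_stable_def)
  have "cylinder {} = UNIV" by (simp add: cylinder_def)
  then show "range (\<lambda>_::nat. UNIV) \<subseteq> cylinder ` {U. finite U}" by (auto intro!: image_eqI[of _ _ "{}"])
  show "emeasure \<mu> UNIV \<noteq> \<infinity>" for i :: nat
    using finite_measure.emeasure_finite[OF assms(1)] by simp
qed (use assms sets_borel_config in auto)

lemma measurable_into_config:
  assumes "\<And>U. finite U \<Longrightarrow> f -` cylinder U \<inter> space M \<in> sets M"
  shows "f \<in> measurable M (borel :: config measure)"
  using sets_borel_config assms by (intro measurable_sigma_sets[where \<Omega> = UNIV]) auto

lemma shift_vimage_cylinder: "shift -` cylinder U = cylinder ((\<lambda>u. u + 1) ` U)"
  by (auto simp: cylinder_def shift_def)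

lemma shift_measurable [measurable]: "shift \<in> measurable borel borel"
  by (rule measurable_into_config) (simp add: shift_vimage_cylinder)

definition coverable :: "nat set \<Rightarrow> int set \<Rightarrow> bool" where
  "coverable B U \<longleftrightarrow> (\<exists>m. \<forall>u\<in>U. m + u \<in> free_set B)"

lemma coverable_shift: "coverable B ((\<lambda>u. u + s) ` U) \<longleftrightarrow> coverable B U"
proof
  assume "coverable B ((\<lambda>u. u + s) ` U)"
  then obtain m where "\<forall>u\<in>U. m + (u + s) \<in> free_set B" by (auto simp: coverable_def)
  then show "coverable B U"
    unfolding coverable_def by (intro exI[of _ "m + s"]) (simp add: algebra_simps)
next
  assume "coverable B U"
  then obtain m where "\<forall>u\<in>U. m + u \<in> free_set B" by (auto simp: coverable_def)
  then show "coverable B ((\<lambda>u. u + s) ` U)"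
    unfolding coverable_def by (intro exI[of _ "m - s"]) (simp add: algebra_simps)
qed

text \<open>The right-hand side is a hereditary subshift that contains \<open>eta B\<close>. Conversely, if \<open>y\<close> belongs to it, then
in any window the pattern of \<open>y\<close> agrees with a configuration below a translate of \<open>eta B\<close>, so \<open>y\<close> is a
limit of points of \<open>X_tilde B\<close>.\<close>
lemma X_tilde_eq: "X_tilde B = - (\<Union>U\<in>{U. finite U \<and> \<not> coverable B U}. cylinder U)" (is "_ = ?Y")
proof
  have mem: "y \<in> ?Y \<longleftrightarrow> (\<forall>U. finite U \<longrightarrow> (\<forall>u\<in>U. y u) \<longrightarrow> coverable B U)" for y
    by (auto simp: cylinder_def)
  have "open (\<Union>U\<in>{U. finite U \<and> \<not> coverable B U}. cylinder U)"
    by (auto intro: open_cylinder)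
  then have "closed ?Y" by (rule closed_Compl)
  have sh: "shift_by s y \<in> ?Y" if "y \<in> ?Y" for s y
    unfolding mem
  proof (intro allI impI)
    fix U assume "finite U" "\<forall>u\<in>U. shift_by s y u"
    then have "coverable B ((\<lambda>u. u + s) ` U)"
      using that unfolding mem by (auto simp: shift_by_def)
    then show "coverable B U" by (simp add: coverable_shift)
  qed
  have "shift ` ?Y = ?Y"
  proof (intro equalityI subsetI)
    fix y assume "y \<in> shift ` ?Y"
    then obtain x where x: "x \<in> ?Y" "y = shift x" by blast
    have "shift x = shift_by 1 x" by (simp add: shift_def shift_by_def)
    then show "y \<in> ?Y" using sh[OF x(1), of 1] x(2) by simp
  next
    fix y assume "y \<in> ?Y"
    then have "shift_by (-1) y \<in> ?Y" by (rule sh)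
    then have "shift (shift_by (-1) y) \<in> shift ` ?Y" by (rule imageI)
    moreover have "shift (shift_by (-1) y) = y" by (simp add: shift_def shift_by_def)
    ultimately show "y \<in> shift ` ?Y" by (simp only:)
  qed
  with \<open>closed ?Y\<close> have "subshift ?Y" by (simp add: subshift_def)
  moreover have "hereditary ?Y"
    unfolding hereditary_def Ball_def mem le_fun_def le_bool_def by blast
  moreover have "orbit_closure (eta B) \<subseteq> ?Y"
    unfolding orbit_closure_def
  proof (rule closure_minimal[OF _ \<open>closed ?Y\<close>])
    have "eta B \<in> ?Y"
      unfolding mem by (auto simp: eta_def coverable_def intro!: exI[of _ 0])
    then show "range (\<lambda>m. shift_by m (eta B)) \<subseteq> ?Y" using sh by blast
  qed
  ultimately show "X_tilde B \<subseteq> ?Y"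
    unfolding X_tilde_def by (rule hereditary_hull)
  show "?Y \<subseteq> X_tilde B"
  proof
    fix y assume y: "y \<in> ?Y"
    have cl: "closed (X_tilde B)" and her: "hereditary (X_tilde B)"
      and orb: "orbit_closure (eta B) \<subseteq> X_tilde B"
      unfolding X_tilde_def using hereditary_hull[of "orbit_closure (eta B)"]
      by (auto simp: subshift_def)
    show "y \<in> X_tilde B"
    proof (rule ccontr)
      assume "y \<notin> X_tilde B"
      moreover have "open (- X_tilde B)" using cl by (rule open_Compl)
      ultimately obtain W where W: "finite W" "\<And>z. (\<forall>w\<in>W. z w = y w) \<Longrightarrow> z \<in> - X_tilde B"
        using open_config_nhd[of "- X_tilde B" y] by (metis ComplI)
      let ?U = "{w\<in>W. y w}"
      have "coverable B ?U" using y W(1) unfolding mem by auto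
      then obtain m where m: "\<forall>u\<in>?U. m + u \<in> free_set B" by (auto simp: coverable_def)
      have "shift_by m (eta B) \<in> X_tilde B"
        using orb closure_subset[THEN subsetD, OF rangeI] unfolding orbit_closure_def
        by (rule subsetD)
      moreover have "(\<lambda>n. n \<in> ?U) \<le> shift_by m (eta B)"
        using m by (auto simp: le_fun_def shift_by_def eta_def add.commute)
      ultimately have "(\<lambda>n. n \<in> ?U) \<in> X_tilde B" using her unfolding hereditary_def by blast
      moreover have "(\<lambda>n. n \<in> ?U) \<notin> X_tilde B" by (rule W(2)[THEN ComplD]) simp
      ultimately show False by contradiction
    qed
  qed
qed

lemma X_tilde_iff:
  "y \<in> X_tilde B \<longleftrightarrow> (\<forall>U. finite U \<longrightarrow> (\<forall>u\<in>U. y u) \<longrightarrow> coverable B U)"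
  unfolding X_tilde_eq by (auto simp: cylinder_def)

lemma X_tilde_mono:
  assumes "free_set B \<subseteq> free_set C" shows "X_tilde B \<subseteq> X_tilde C"
proof -
  have "coverable C U" if "coverable B U" for U
    using that assms unfolding coverable_def by blast
  then show ?thesis by (auto simp: X_tilde_iff)
qed

lemma X_tilde_borel [measurable]: "X_tilde B \<in> sets borel"
  unfolding X_tilde_eq by (intro borel_closed closed_Compl open_UN) (auto intro: open_cylinder)

lemma measure_cylinder_shift:
  assumes "sets \<mu> = sets borel" "distr \<mu> borel shift = \<mu>" "finite U"
  shows "measure \<mu> (cylinder ((\<lambda>u. u + int n) ` U)) = measure \<mu> (cylinder U)"
proof (induction n)
  case (Suc n)
  let ?V = "(\<lambda>u. u + int n) ` U"
  have "measure \<mu> (cylinder ?V) = measure (distr \<mu> borel shift) (cylinder ?V)"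
    using assms by simp
  also have "\<dots> = measure \<mu> (cylinder ((\<lambda>u. u + 1) ` ?V))"
    using assms sets_eq_imp_space_eq[OF assms(1)]
    by (subst measure_distr) (auto simp: shift_vimage_cylinder measurable_cong_sets[OF assms(1) refl])
  also have "(\<lambda>u. u + 1) ` ?V = (\<lambda>u. u + int (Suc n)) ` U"
    by (auto simp: image_image algebra_simps)
  finally show ?case using Suc by simp
qed simp

text \<open>By invariance the measure of the cylinder is the mean frequency of \<open>U\<close> in a window of length \<open>L = k!\<close>. A
configuration of \<open>X_tilde B\<close> restricted to such a window lies below a translate of the \<open>trunc B k\<close>-free
integers, whose period is \<open>L\<close>, so \<open>U\<close> occurs at most \<open>L * free_prob (trunc B k) U\<close> times.\<close>
lemma invariant_measure_cylinder_le:
  assumes B: "0 \<notin> B" and \<mu>: "\<mu> \<in> invariant_measures (X_tilde B)" and U: "finite U"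
  shows "measure \<mu> (cylinder U) \<le> free_prob B U"
proof -
  interpret prob_space \<mu> using \<mu> by (simp add: invariant_measures_def)
  have sets[measurable_cong]: "sets \<mu> = sets borel" and inv: "distr \<mu> borel shift = \<mu>"
    and X: "emeasure \<mu> (X_tilde B) = 1"
    using \<mu> by (auto simp: invariant_measures_def)
  have AE: "AE y in \<mu>. y \<in> X_tilde B"
    using X by (intro AE_prob_1) (simp add: measure_def)
  have bound: "measure \<mu> (cylinder U) \<le> free_prob (trunc B k) U" for k
  proof -
    let ?K = "trunc B k" and ?L = "fact k :: nat"
    let ?A = "{m. \<forall>u\<in>U. m + u \<in> free_set ?K}"
    let ?c = "card (?A \<inter> {0..<int ?L})"
    let ?C = "\<lambda>n. cylinder ((\<lambda>u. u + int n) ` U)"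
    have K: "0 < b \<and> b \<le> k" if "b \<in> ?K" for b
      using that B by (auto simp: trunc_def intro: Nat.gr0I)
    have FK: "free_set B \<subseteq> free_set ?K" by (auto simp: free_set_iff trunc_def)
    have count: "(\<Sum>n<?L. indicat_real (?C n) y) \<le> ?c" if y: "y \<in> X_tilde B" for y
    proof -
      let ?T = "{n. n < ?L \<and> y \<in> ?C n}"
      have "finite (\<Union>n\<in>?T. (\<lambda>u. u + int n) ` U)" using U by auto
      then have "coverable B (\<Union>n\<in>?T. (\<lambda>u. u + int n) ` U)"
        using y unfolding X_tilde_iff by (elim allE impE) (auto simp: cylinder_def)
      then obtain m where m: "\<And>n u. n \<in> ?T \<Longrightarrow> u \<in> U \<Longrightarrow> m + (u + int n) \<in> free_set B"
        unfolding coverable_def by blast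
      have "(\<lambda>n. m + int n) ` ?T \<subseteq> ?A \<inter> {m..<m + int ?L}"
        using m FK by (auto simp: algebra_simps simp del: of_nat_fact)
      then have "card ((\<lambda>n. m + int n) ` ?T) \<le> card (?A \<inter> {m..<m + int ?L})"
        by (intro card_mono) auto
      also have "\<dots> = ?c"
        using free_prob_finite_periodic(2)[of ?K k U] K by (intro card_shift_period) auto
      finally have "card ?T \<le> ?c" by (simp add: card_image inj_on_def)
      moreover have "(\<Sum>n<?L. indicat_real (?C n) y) = card ?T"
        by (simp add: indicator_def sum.If_cases Int_def)
      ultimately show ?thesis by simp
    qed
    have "?L * measure \<mu> (cylinder U) = (\<Sum>n<?L. measure \<mu> (?C n))"
      using measure_cylinder_shift[OF sets inv U] by simp
    also have "\<dots> = (\<integral>y. (\<Sum>n<?L. indicat_real (?C n) y) \<partial>\<mu>)"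
      using U by (subst Bochner_Integration.integral_sum) (auto simp: integrable_real_indicator emeasure_eq_measure sets)
    also have "\<dots> \<le> (\<integral>y. real ?c \<partial>\<mu>)"
    proof (rule integral_mono_AE)
      show "AE y in \<mu>. (\<Sum>n<?L. indicat_real (?C n) y) \<le> real ?c"
        using AE by (rule eventually_mono) (rule count)
      show "integrable \<mu> (\<lambda>y. \<Sum>n<?L. indicat_real (?C n) y)"
        using U by (intro Bochner_Integration.integrable_sum integrable_real_indicator)
          (auto simp: emeasure_eq_measure sets)
    qed simp
    also have "\<dots> = ?c" by (simp add: prob_space)
    also have "\<dots> = ?L * free_prob ?K U"
      using free_prob_finite_periodic(1)[of ?K k U] K by simp
    finally show ?thesis by simp
  qed
  show ?thesis
    by (rule LIMSEQ_le_const[OF free_prob_trunc]) (use bound in blast)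
qed

text \<open>Almost every point avoids the countably many null cylinders. A pattern without a translate among the
\<open>B\<close>-free integers is null by \<open>free_prob_pos_translate\<close>, so almost every point lies in \<open>X_tilde B\<close>.\<close>
lemma invariant_measures_X_tilde:
  assumes B: "0 \<notin> B"
  shows "\<mu> \<in> invariant_measures (X_tilde B) \<longleftrightarrow>
    prob_space \<mu> \<and> sets \<mu> = sets borel \<and> distr \<mu> borel shift = \<mu> \<and>
    (\<forall>U. finite U \<longrightarrow> free_prob B U = 0 \<longrightarrow> measure \<mu> (cylinder U) = 0)" (is "?L \<longleftrightarrow> ?R")
proof
  assume \<mu>: ?L
  have "measure \<mu> (cylinder U) = 0" if "finite U" "free_prob B U = 0" for U
    using invariant_measure_cylinder_le[OF B \<mu> that(1)] that(2) measure_nonneg[of \<mu> "cylinder U"] by linarith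
  with \<mu> show ?R by (auto simp: invariant_measures_def)
next
  assume \<mu>: ?R
  then interpret prob_space \<mu> by simp
  have sets[measurable_cong]: "sets \<mu> = sets borel" using \<mu> by simp
  have sp: "space \<mu> = UNIV" using sets_eq_imp_space_eq[OF sets] by simp
  let ?N = "\<Union>U\<in>{U. finite U \<and> \<not> coverable B U}. cylinder U"
  have "?N \<in> null_sets \<mu>"
  proof (rule null_sets_UN')
    show "countable {U. finite U \<and> \<not> coverable B U}"
      by (rule countable_subset[OF _ countable_Collect_finite]) auto
    fix U assume "U \<in> {U. finite U \<and> \<not> coverable B U}"
    then have U: "finite U" "\<not> coverable B U" by auto
    then have "free_prob B U = 0"
      using free_prob_pos_translate[OF B U(1)] free_prob_nonneg[of B U]
      by (auto simp: coverable_def less_le)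
    then show "cylinder U \<in> null_sets \<mu>"
      using \<mu> U(1) by (auto simp: null_sets_def emeasure_eq_measure sets)
  qed
  then have "emeasure \<mu> (space \<mu> - ?N) = emeasure \<mu> (space \<mu>)"
    by (intro emeasure_Diff_null_set) auto
  then have "emeasure \<mu> (X_tilde B) = 1"
    using emeasure_space_1 by (simp add: X_tilde_eq sp Compl_eq_Diff_UNIV)
  with \<mu> show ?L by (simp add: invariant_measures_def)
qed

definition mirsky :: "nat set \<Rightarrow> config measure" where
  "mirsky B = distr haar borel (\<lambda>\<omega> n. \<omega> \<in> sieve B {n})"

lemma sieve_vimage_cylinder: "(\<lambda>\<omega> n. \<omega> \<in> sieve B {n}) -` cylinder U = sieve B U"
  by (auto simp: cylinder_def sieve_def)

lemma mirsky_measurable [measurable]: "(\<lambda>\<omega> n. \<omega> \<in> sieve B {n}) \<in> measurable haar borel"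
  by (rule measurable_into_config) (simp add: sieve_vimage_cylinder)

lemma emeasure_mirsky_cylinder:
  assumes "finite U" shows "emeasure (mirsky B) (cylinder U) = ennreal (free_prob B U)"
  unfolding mirsky_def using assms
  by (subst emeasure_distr) (auto simp: sieve_vimage_cylinder free_prob_def haar.emeasure_eq_measure)

lemma mirsky_invariant:
  assumes B: "0 \<notin> B" shows "mirsky B \<in> invariant_measures (X_tilde B)"
  unfolding invariant_measures_X_tilde[OF B]
proof (intro conjI allI impI)
  show ps: "prob_space (mirsky B)"
    unfolding mirsky_def by (rule haar.prob_space_distr) measurable
  show sets[measurable_cong]: "sets (mirsky B) = sets borel" by (simp add: mirsky_def)
  show "distr (mirsky B) borel shift = mirsky B"
  proof (rule config_measure_eqI)
    show "finite_measure (distr (mirsky B) borel shift)"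
      using ps by (intro prob_space.finite_measure prob_space.prob_space_distr) measurable
    fix U :: "int set" assume U: "finite U"
    have "emeasure (distr (mirsky B) borel shift) (cylinder U) = emeasure (mirsky B) (cylinder ((\<lambda>u. u + 1) ` U))"
      using U sets_eq_imp_space_eq[OF sets]
      by (subst emeasure_distr) (auto simp: shift_vimage_cylinder)
    then show "emeasure (distr (mirsky B) borel shift) (cylinder U) = emeasure (mirsky B) (cylinder U)"
      using U by (simp add: emeasure_mirsky_cylinder free_prob_shift[OF B])
  qed (simp_all add: sets)
  show "measure (mirsky B) (cylinder U) = 0" if "finite U" "free_prob B U = 0" for U
    using that by (simp add: measure_def emeasure_mirsky_cylinder)
qed

text \<open>The Mirsky measure of \<open>B\<close> charges exactly the patterns that are not null for \<open>B\<close>.\<close>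
lemma invariant_measures_subset_iff:
  assumes "0 \<notin> B" "0 \<notin> C"
  shows "invariant_measures (X_tilde B) \<subseteq> invariant_measures (X_tilde C) \<longleftrightarrow>
     (\<forall>U. finite U \<longrightarrow> free_prob C U = 0 \<longrightarrow> free_prob B U = 0)"
proof
  assume "invariant_measures (X_tilde B) \<subseteq> invariant_measures (X_tilde C)"
  then have "mirsky B \<in> invariant_measures (X_tilde C)" using mirsky_invariant[OF assms(1)] by blast
  then show "\<forall>U. finite U \<longrightarrow> free_prob C U = 0 \<longrightarrow> free_prob B U = 0"
    unfolding invariant_measures_X_tilde[OF assms(2)]
    by (simp add: measure_def emeasure_mirsky_cylinder)
next
  assume "\<forall>U. finite U \<longrightarrow> free_prob C U = 0 \<longrightarrow> free_prob B U = 0"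
  then show "invariant_measures (X_tilde B) \<subseteq> invariant_measures (X_tilde C)"
    using assms by (intro subsetI) (simp add: invariant_measures_X_tilde)
qed

section \<open>Existence and uniqueness of the taut set\<close>

theorem theorem3:
  fixes B :: "nat set"
  assumes "0 \<notin> B"
  shows "\<exists>!B' :: nat set. 0 \<notin> B' \<and> taut B' \<and>
           free_set B' \<subseteq> free_set B \<and>
           X_tilde B' \<subseteq> X_tilde B \<and>
           invariant_measures (X_tilde B) = invariant_measures (X_tilde B')"
proof -
  obtain B' where B': "0 \<notin> B'" "taut B'" "free_set B' \<subseteq> free_set B"
    and same: "\<And>U. free_prob B' U = free_prob B U"
    using exists_taut[OF assms] by blast
  have inv: "invariant_measures (X_tilde B) = invariant_measures (X_tilde B')"
    using invariant_measures_subset_iff[OF assms B'(1)] invariant_measures_subset_iff[OF B'(1) assms]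
    by (intro equalityI) (simp_all add: same)
  have unique: "C = B'"
    if C: "0 \<notin> C" "taut C" "invariant_measures (X_tilde B) = invariant_measures (X_tilde C)" for C
  proof -
    have "invariant_measures (X_tilde C) \<subseteq> invariant_measures (X_tilde B')"
      "invariant_measures (X_tilde B') \<subseteq> invariant_measures (X_tilde C)"
      using C(3) inv by simp_all
    then have "free_prob C U = 0 \<longleftrightarrow> free_prob B' U = 0" if "finite U" for U
      using that invariant_measures_subset_iff[OF C(1) B'(1)]
        invariant_measures_subset_iff[OF B'(1) C(1)] by blast
    then show ?thesis
      using taut_unique[OF C(1,2) B'(1,2)] taut_unique[OF B'(1,2) C(1,2)] by blast
  qed
  show ?thesis
  proof (rule ex1I[of _ B'])
    show "0 \<notin> B' \<and> taut B' \<and> free_set B' \<subseteq> free_set B \<and> X_tilde B' \<subseteq> X_tilde B \<and>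
        invariant_measures (X_tilde B) = invariant_measures (X_tilde B')"
      using B' inv X_tilde_mono[OF B'(3)] by simp
  qed (elim conjE, rule unique)
qed

end
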